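(* Let $n\geq 2$ and $\gamma \geq 0$. For $\mu >0$, let $R_\mu^{\mathcal{N}}$ denote any cuboid which minimises $\operatorname{Tr}(-\Delta_R^{\mathcal{N}}-\mu)_-^\gamma$ among all $n$-dimensional cuboids $R$ of unit measure, and let $a_{1,\mu}^*\le\dots\le a_{n,\mu}^*$ be its side-lengths. Then, for any admissible exponent $\theta_n$ (as defined in the context), as $\mu \to \infty$, $$a_{n,\mu}^* = 1+O\bigl(\mu^{(\theta_n-(n-1))/4}\bigr).$$
   Context: An $n$-dimensional cuboid of unit measure is a domain $R=\prod_{i=1}^n (0,a_i)\subset\mathbb{R}^n$ with $a_i>0$, $\prod_{i=1}^n a_i=1$, with side-lengths labelled so that $a_1\le\dots\le a_n$. $0=\mu_0(R)\le\mu_1(R)\le\dots$ are the eigenvalues of the Neumann Laplacian $-\Delta_R^{\mathcal{N}}$ on $R$, repeated according to multiplicity and indexed from $0$: the numbers $\sum_{j=1}^n \pi^2 i_j^2/a_j^2$ with $i_j$ non-negative integers. The Riesz mean of order $\gamma\ge0$ is $$\operatorname{Tr}(-\Delta_R^{\mathcal{N}}-\mu)_-^\gamma=\sum_{k\ge0:\,\mu_k(R)\le\mu}(\mu-\mu_k(R))^\gamma,$$ with the convention $0^0=1$, so that for $\gamma=0$ it is the counting function $\#\{k\ge0:\mu_k(R)\le\mu\}$. A minimising cuboid exists (it need not be unique). Admissible exponent: $\theta_n$ denotes any exponent such that for all $a_1,\dots,a_n>0$, $$\#\{z\in\mathbb{Z}^n: a_1^{-2}z_1^2+\dots+a_n^{-2}z_n^2\le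 t^2\}-\omega_n t^n\prod_{i=1}^n a_i = O(t^{\theta_n}),\quad t\to\infty,$$ uniformly for $a_1,\dots,a_n$ in compact subsets of $(0,\infty)$, where $\omega_n$ is the volume of the unit ball in $\mathbb{R}^n$. It is known that for every $n\ge2$ there are admissible exponents with $\theta_n<n-1$. *)

theory Defs
  imports "HOL-Analysis.Analysis" "HOL-Library.Landau_Symbols"
begin

text \<open>
  A cuboid is given by its side-lengths \<open>a 1 \<le> \<dots> \<le> a n\<close>; the values of \<open>a\<close> outside
  \<open>{1..n}\<close> play no role.
\<close>

definition unit_cuboid :: "nat \<Rightarrow> (nat \<Rightarrow> real) \<Rightarrow> bool" where
  "unit_cuboid n a \<longleftrightarrow>
     (\<forall>i\<in>{1..n}. 0 < a i) \<and> (\<Prod>i=1..n. a i) = 1 \<and> mono_on {1..n} a"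

text \<open>
  The Neumann Laplacian on \<open>(0, a 1) \<times> \<dots> \<times> (0, a n)\<close> has the eigenfunctions
  \<open>x \<mapsto> \<Prod>j. cos (pi * i j * x j / a j)\<close>, one for each multi-index \<open>i\<close> of natural numbers.
\<close>

definition neumann_mode :: "nat \<Rightarrow> (nat \<Rightarrow> real) \<Rightarrow> (nat \<Rightarrow> nat) \<Rightarrow> real" where
  "neumann_mode n a i = (\<Sum>j=1..n. pi\<^sup>2 * (real (i j))\<^sup>2 / (a j)\<^sup>2)"

text \<open>
  The \<open>k\<close>-th smallest of the numbers \<open>neumann_mode n a i\<close>, counted from \<open>0\<close> and with one
  repetition for each multi-index: the least \<open>l\<close> such that more than \<open>k\<close> multi-indices have
  value at most \<open>l\<close>.
\<close>

definition neumann_eigenvalue :: "nat \<Rightarrow> (nat \<Rightarrow> real) \<Rightarrow> nat \<Rightarrow> real" where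
  "neumann_eigenvalue n a k =
     Inf {l. k < card {i \<in> {1..n} \<rightarrow>\<^sub>E (UNIV :: nat set). neumann_mode n a i \<le> l}}"

text \<open>The case distinction implements the convention \<open>0\<^sup>0 = 1\<close>; in HOL, \<open>0 powr 0 = 0\<close>.\<close>

definition neumann_riesz_mean :: "nat \<Rightarrow> real \<Rightarrow> real \<Rightarrow> (nat \<Rightarrow> real) \<Rightarrow> real" where
  "neumann_riesz_mean n \<gamma> \<mu> a =
     (\<Sum>k | neumann_eigenvalue n a k \<le> \<mu>.
        if \<gamma> = 0 then 1 else (\<mu> - neumann_eigenvalue n a k) powr \<gamma>)"

definition minimising_cuboid :: "nat \<Rightarrow> real \<Rightarrow> real \<Rightarrow> (nat \<Rightarrow> real) \<Rightarrow> bool" where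
  "minimising_cuboid n \<gamma> \<mu> a \<longleftrightarrow> is_arg_min (neumann_riesz_mean n \<gamma> \<mu>) (unit_cuboid n) a"

definition ellipsoid_lattice_count :: "nat \<Rightarrow> (nat \<Rightarrow> real) \<Rightarrow> real \<Rightarrow> nat" where
  "ellipsoid_lattice_count n a t =
     card {z \<in> {1..n} \<rightarrow>\<^sub>E (UNIV :: int set). (\<Sum>i=1..n. (real_of_int (z i))\<^sup>2 / (a i)\<^sup>2) \<le> t\<^sup>2}"

definition admissible_exponent :: "nat \<Rightarrow> real \<Rightarrow> bool" where
  "admissible_exponent n \<theta> \<longleftrightarrow>
     (\<forall>K. compact K \<and> K \<subseteq> {0<..} \<longrightarrow>
        (\<exists>C. \<forall>\<^sub>F t in at_top. \<forall>a \<in> {1..n} \<rightarrow> K.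
           \<bar>real (ellipsoid_lattice_count n a t) - unit_ball_vol (real n) * t ^ n * (\<Prod>i=1..n. a i)\<bar>
             \<le> C * t powr \<theta>))"

end

theory Submission imports Defs begin

text \<open>
  Counting non-negative lattice points amounts to averaging the integer lattice point counts of all
  coordinate sections of the ellipsoid. Hence, for \<open>a\<close> in a compact set and \<open>s = (pi * t)\<^sup>2\<close>, the
  number of Neumann eigenvalues up to \<open>s\<close> has a Weyl term depending only on \<open>\<Prod>j. a j\<close>, then a term
  \<open>c * (\<Sum>j. 1 / a j) * t ^ (n - 1)\<close>, and the error is \<open>O(t powr \<theta>)\<close>: the sections of codimension
  at least \<open>2\<close> contribute \<open>O(t ^ (n - 2))\<close>, and \<open>\<theta> \<ge> n - 2\<close> for every admissible exponent.
  Integrating against the Riesz kernel and comparing a minimiser with the unit cube bounds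
  \<open>(\<Sum>j. 1 / a j) - n\<close>, which controls the square of \<open>a n - 1\<close> from above; this is where the
  exponent is halved once more.

  That minimisers stay in a compact set follows from a lower bound for the counting function of an
  arbitrary cuboid, in which the Weyl term is improved by a multiple of \<open>t ^ (n - 1) / a 1\<close>.
\<close>

subsection \<open>Sums and integrals of decreasing functions\<close>

text \<open>The obstacle is that admissibility is uniform only on compact sets of side-lengths,
  while minimisers might degenerate as \<mu> grows. The first bound must therefore hold for every
  cuboid. Slicing writes the count as a sum of a decreasing profile over k = 0, 1, ..., which
  exceeds its integral. For slices of dimension at least 1 the excess is close to 1 when the spacing
  is coarse (short side) and close to 1/2 when it is fine, so it is bounded below throughout; the
  constants \<open>512\<close> and \<open>2 ^ m\<close> are convenient, not optimal. Along the
  shortest side the slices have volume proportional to \<open>1 / a 1\<close>, so a very thin cuboid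
  would lose against the unit cube already at order \<open>t ^ (n - 1)\<close>.

  On the resulting compact set the cube minimises \<open>\<Sum>j. 1 / a j\<close> among sides of
  product 1. Only one-sided estimates are needed, from below for the minimiser and from above for
  the cube. Near this minimum the excess of the sum is of second order, which is why it yields only
  the square of the deviation.\<close>

lemma integral_antimono_le_half_sum:
  fixes f :: "real \<Rightarrow> real"
  assumes f: "\<And>x y. 0 \<le> x \<Longrightarrow> x \<le> y \<Longrightarrow> f y \<le> f x"
  shows "f integrable_on {0..real K}"
    and "integral {0..real K} f \<le> (\<Sum>k<K. (f (real k) + f (real k + 1 / 2)) / 2)"
    and "(\<Sum>k<K. f (real k)) \<le> integral {0..real K} f + f 0 - f (real K)"
proof -
  have int: "f integrable_on {a..b}" if "0 \<le> a" for a b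
  proof -
    have "mono_on {a..b} (\<lambda>x. - f x)"
      using f that by (intro mono_onI) auto
    then have "(\<lambda>x. - f x) integrable_on {a..b}"
      by (rule integrable_on_mono_on)
    then show ?thesis
      using integrable_neg by fastforce
  qed
  show "f integrable_on {0..real K}"
    by (rule int) simp
  have bounds: "integral {a..b} f \<le> (b - a) * f a" "(b - a) * f b \<le> integral {a..b} f"
    if "0 \<le> a" "a \<le> b" for a b
  proof -
    have "integral {a..b} f \<le> integral {a..b} (\<lambda>_. f a)"
      using that int f by (intro integral_le) auto
    then show "integral {a..b} f \<le> (b - a) * f a"
      using that by simp
    have "integral {a..b} (\<lambda>_. f b) \<le> integral {a..b} f"
      using that int f by (intro integral_le) auto
    then show "(b - a) * f b \<le> integral {a..b} f"
      using that by simp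
  qed
  \<comment> \<open>This is the upper Riemann sum of mesh 1/2. Compared with
    \<open>\<Sum>k<K. f (real k)\<close> it saves half of each drop from \<open>k\<close> to
    \<open>k + 1 / 2\<close>; these savings are the source of the gap for thin cuboids.\<close>
  show "integral {0..real K} f \<le> (\<Sum>k<K. (f (real k) + f (real k + 1 / 2)) / 2)"
  proof (induction K)
    case (Suc K)
    have "integral {0..real (Suc K)} f = integral {0..real K} f + integral {real K..real K + 1} f"
      using Henstock_Kurzweil_Integration.integral_combine[of 0 "real K" "real K + 1" f] int by (simp add: add.commute)
    also have "integral {real K..real K + 1} f =
        integral {real K..real K + 1 / 2} f + integral {real K + 1 / 2..real K + 1} f"
      using Henstock_Kurzweil_Integration.integral_combine[of "real K" "real K + 1 / 2" "real K + 1" f] int by simp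
    finally show ?case
      using Suc bounds(1)[of "real K" "real K + 1 / 2"] bounds(1)[of "real K + 1 / 2" "real K + 1"]
      by (simp add: add_divide_distrib)
  qed simp
  \<comment> \<open>The lower Riemann sum of mesh 1 uses right end points; shifting the index by one
    produces \<open>f 0 - f (real K)\<close>.\<close>
  show "(\<Sum>k<K. f (real k)) \<le> integral {0..real K} f + f 0 - f (real K)"
  proof (induction K)
    case (Suc K)
    have "integral {0..real (Suc K)} f = integral {0..real K} f + integral {real K..real K + 1} f"
      using Henstock_Kurzweil_Integration.integral_combine[of 0 "real K" "real K + 1" f] int by (simp add: add.commute)
    then show ?case
      using Suc bounds(2)[of "real K" "real K + 1"] by (simp add: add.commute)
  qed simp
qed

text \<open>At height \<open>y \<ge> 0\<close>, the section of the unit ball of dimension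
  \<open>m + 1\<close> has volume \<open>unit_ball_vol m\<close> times this factor. The cut-off at 1
  matters: \<open>sqrt\<close> is an odd function in HOL, so odd powers would turn negative beyond
  1, and for \<open>m = 0\<close> the power is constantly 1.\<close>

definition ball_profile :: "nat \<Rightarrow> real \<Rightarrow> real" where
  "ball_profile m y = (if y \<le> 1 then sqrt (1 - y\<^sup>2) ^ m else 0)"

definition profile_integral :: "nat \<Rightarrow> real" where
  "profile_integral m = integral {0..1} (ball_profile m)"

lemma ball_profile_nonneg: "0 \<le> y \<Longrightarrow> 0 \<le> ball_profile m y"
  by (auto simp: ball_profile_def power_le_one intro!: zero_le_power)

lemma ball_profile_antimono:
  assumes "0 \<le> x" "x \<le> y"
  shows "ball_profile m y \<le> ball_profile m x"
  using assms ball_profile_nonneg[of x m]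
  by (auto simp: ball_profile_def power_le_one intro!: power_mono)

lemma has_integral_ball_profile:
  assumes "0 < M" "M \<le> R"
  shows "((\<lambda>x. ball_profile m (x / M)) has_integral M * profile_integral m) {0..R}"
proof -
  let ?g = "\<lambda>y. if y \<in> {0..1} then ball_profile m y else 0"
  have "ball_profile m integrable_on {0..1}"
    using integral_antimono_le_half_sum(1)[of "ball_profile m" 1] ball_profile_antimono by simp
  then have "(?g has_integral profile_integral m) {0..1}"
    unfolding profile_integral_def by (subst has_integral_cong[of _ _ "ball_profile m"]) auto
  then have "(?g has_integral profile_integral m) {0..R / M}"
    by (rule has_integral_on_superset) (use assms in auto)
  then have "(ball_profile m has_integral profile_integral m) {0..R / M}"
    by (rule has_integral_eq[rotated]) (auto simp: ball_profile_def)
  then have "((\<lambda>x. ball_profile m ((1 / M) * x)) has_integral (1 / \<bar>1 / M\<bar>) *\<^sub>R profile_integral m)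
      ((\<lambda>x. x / (1 / M)) ` {0..R / M})"
    using has_integral_stretch_real[of "ball_profile m" "profile_integral m" 0 "R / M" "1 / M"] assms
    by simp
  moreover have "(\<lambda>x. x / (1 / M)) ` {0..R / M} = {0..R}"
    using assms image_mult_atLeastAtMost[of M 0 "R / M"] by (simp add: mult.commute[of _ M])
  ultimately show ?thesis
    using assms by simp
qed

text \<open>The quotient of the Gamma values in \<open>unit_ball_vol_def\<close> is recognised as
  \<open>Beta (1 / 2) (real m / 2 + 1)\<close>, whose integral representation over [-1, 1] is the
  auxiliary fact behind the volume of a ball. Evenness of the integrand gives the factor 2.\<close>

lemma unit_ball_vol_Suc:
  "unit_ball_vol (real (Suc m)) = 2 * profile_integral m * unit_ball_vol (real m)"
proof -
  define g where "g = (\<lambda>x::real. indicator {-1..1} x * sqrt (1 - x\<^sup>2) ^ m)"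
  have sq: "x\<^sup>2 \<le> 1" if "x \<in> {-1..1}" for x :: real
    using that by (simp add: abs_square_le_1 abs_le_iff)
  have "(g has_integral Beta (1 / 2) (real m / 2 + 1)) UNIV"
  proof (rule nn_integral_has_integral)
    show "g \<in> borel_measurable borel"
      unfolding g_def by measurable
    show "0 \<le> g x" for x
      using sq[of x] by (auto simp: g_def indicator_def)
    show "(\<integral>\<^sup>+x. ennreal (g x) \<partial>lborel) = ennreal (Beta (1 / 2) (real m / 2 + 1))"
      unfolding g_def by (rule emeasure_cball_aux_integral)
    show "0 \<le> Beta (1 / 2) (real m / 2 + 1)"
      unfolding Beta_def by (intro divide_nonneg_nonneg mult_nonneg_nonneg less_imp_le Gamma_real_pos) auto
  qed
  moreover have "g = (\<lambda>x. if x \<in> {-1..1} then sqrt (1 - x\<^sup>2) ^ m else 0)"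
    by (auto simp: g_def indicator_def)
  ultimately have "((\<lambda>x. sqrt (1 - x\<^sup>2) ^ m) has_integral Beta (1 / 2) (real m / 2 + 1)) {-1..1}"
    by (simp only: has_integral_restrict_UNIV)
  then have "Beta (1 / 2) (real m / 2 + 1) = integral {-1..1} (\<lambda>x. sqrt (1 - x\<^sup>2) ^ m)"
    by (simp add: integral_unique)
  also have "\<dots> = integral {-1..0} (\<lambda>x. sqrt (1 - x\<^sup>2) ^ m) + integral {0..1} (\<lambda>x. sqrt (1 - x\<^sup>2) ^ m)"
    by (rule Henstock_Kurzweil_Integration.integral_combine [symmetric]) (auto intro!: integrable_continuous_real continuous_intros)
  also have "integral {-1..0} (\<lambda>x. sqrt (1 - x\<^sup>2) ^ m) = integral {0..1} (\<lambda>x. sqrt (1 - x\<^sup>2) ^ m)"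
    using Henstock_Kurzweil_Integration.integral_reflect_real[of 1 0 "\<lambda>x. sqrt (1 - x\<^sup>2) ^ m"] by simp
  also have "integral {0..1} (\<lambda>x. sqrt (1 - x\<^sup>2) ^ m) = profile_integral m"
    unfolding profile_integral_def by (rule integral_cong) (simp add: ball_profile_def)
  finally have B: "Beta (1 / 2) (real m / 2 + 1) = 2 * profile_integral m"
    by simp
  have "0 < 1 + real m / 2"
    by (simp add: add_pos_nonneg)
  then have nonzero: "Gamma (1 + real m / 2) \<noteq> 0"
    using Gamma_real_pos[of "1 + real m / 2"] by linarith
  show ?thesis
    unfolding B [symmetric] Beta_def unit_ball_vol_def
    by (simp add: nonzero Gamma_one_half_real add_divide_distrib powr_add powr_half_sqrt add_ac)
qed

text \<open>With \<open>u\<close> and \<open>v\<close> the square roots at \<open>x\<close> and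
  \<open>y\<close>, one has \<open>y\<^sup>2 - x\<^sup>2 = (u - v) * (u + v)\<close> and
  \<open>u ^ m - v ^ m \<ge> (u - v) * v ^ (m - 1)\<close>. The bound \<open>y \<le> 3 / 4\<close>
  keeps \<open>v \<ge> 1 / 2\<close>, and \<open>m \<ge> 1\<close> excludes the profile that is flat
  on [0, 1].\<close>

lemma ball_profile_decrease:
  assumes m: "m \<ge> 1" and x: "0 \<le> x" "x \<le> y" "y \<le> 3 / 4"
  shows "(y\<^sup>2 - x\<^sup>2) / 2 ^ m \<le> ball_profile m x - ball_profile m y"
proof -
  obtain m' where m': "m = Suc m'"
    using m by (cases m) auto
  define u v where "u = sqrt (1 - x\<^sup>2)" and "v = sqrt (1 - y\<^sup>2)"
  have xy: "y\<^sup>2 \<le> (3 / 4)\<^sup>2" "x\<^sup>2 \<le> y\<^sup>2"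
    using x by (auto intro!: power_mono)
  then have "(1 / 2)\<^sup>2 \<le> 1 - y\<^sup>2"
    by (simp add: power2_eq_square)
  then have "1 / 2 \<le> v"
    unfolding v_def by (rule real_le_rsqrt)
  moreover have "v \<le> u" "u \<le> 1" "u\<^sup>2 = 1 - x\<^sup>2" "v\<^sup>2 = 1 - y\<^sup>2"
    using xy by (auto simp: u_def v_def power2_eq_square)
  ultimately have v: "1 / 2 \<le> v" "v \<le> u" "u \<le> 1" "u\<^sup>2 = 1 - x\<^sup>2" "v\<^sup>2 = 1 - y\<^sup>2"
    by auto
  have "y\<^sup>2 - x\<^sup>2 = (u - v) * (u + v)"
    using v by (simp add: algebra_simps power2_eq_square)
  also have "\<dots> \<le> (u - v) * 2"
    using v by (intro mult_left_mono) auto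
  finally have uv: "(y\<^sup>2 - x\<^sup>2) / 2 \<le> u - v"
    by simp
  have "(y\<^sup>2 - x\<^sup>2) / 2 ^ m = (y\<^sup>2 - x\<^sup>2) / 2 * (1 / 2) ^ m'"
    by (simp add: m' power_divide)
  also have "\<dots> \<le> (u - v) * v ^ m'"
    using uv v xy by (intro mult_mono power_mono) auto
  also have "\<dots> \<le> u ^ m - v ^ m"
    using v by (auto simp: m' algebra_simps intro!: mult_left_mono power_mono)
  finally show ?thesis
    using x by (simp add: ball_profile_def u_def v_def)
qed

lemma sum_ball_profile_bounds:
  assumes "0 < M" "M \<le> real K"
  shows "M * profile_integral m \<le> (\<Sum>k<K. ball_profile m (real k / M))"
    and "(\<Sum>k<K. ball_profile m (real k / M)) \<le> M * profile_integral m + 1"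
proof -
  let ?f = "\<lambda>x. ball_profile m (x / M)"
  have anti: "?f y \<le> ?f x" if "0 \<le> x" "x \<le> y" for x y
    using that assms by (intro ball_profile_antimono) (auto simp: divide_right_mono)
  have int: "integral {0..real K} ?f = M * profile_integral m"
    using has_integral_ball_profile[OF assms] by (rule integral_unique)
  have "(\<Sum>k<K. (?f (real k) + ?f (real k + 1 / 2)) / 2) \<le> (\<Sum>k<K. ?f (real k))"
    using anti[of "real k" "real k + 1 / 2" for k] by (intro sum_mono) (simp add: field_simps)
  with integral_antimono_le_half_sum(2)[of ?f K] anti int
  show "M * profile_integral m \<le> (\<Sum>k<K. ?f (real k))"
    by simp
  have "?f 0 = 1"
    by (simp add: ball_profile_def)
  with integral_antimono_le_half_sum(3)[of ?f K] anti int ball_profile_nonneg[of "real K / M" m] assms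
  show "(\<Sum>k<K. ?f (real k)) \<le> M * profile_integral m + 1"
    by simp
qed

text \<open>The lower Riemann sum bound has a gap that does not degenerate as \<open>M \<rightarrow> 0\<close> or
  \<open>M \<rightarrow> \<infinity>\<close>. For \<open>M \<le> 8\<close> the gap is found at \<open>k = 0\<close>; for \<open>M \<ge> 8\<close> it is collected over
  \<open>M / 4 \<le> k \<le> M / 2\<close>.\<close>

lemma sum_ball_profile_gap:
  assumes m: "m \<ge> 1" and M: "0 < M" "M \<le> real K"
  shows "M * profile_integral m + 1 / (512 * 2 ^ m) \<le> (\<Sum>k<K. ball_profile m (real k / M))"
proof -
  let ?f = "\<lambda>x. ball_profile m (x / M)"
  let ?d = "\<lambda>k. ?f (real k) - ?f (real k + 1 / 2)"
  have anti: "?f y \<le> ?f x" if "0 \<le> x" "x \<le> y" for x y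
    using that assms by (intro ball_profile_antimono) (auto simp: divide_right_mono)
  have int: "integral {0..real K} ?f = M * profile_integral m"
    using has_integral_ball_profile[OF M] by (rule integral_unique)
  have "(\<Sum>k<K. (?f (real k) + ?f (real k + 1 / 2)) / 2) = (\<Sum>k<K. ?f (real k) - ?d k / 2)"
    by (intro sum.cong) (auto simp: field_simps)
  also have "\<dots> = (\<Sum>k<K. ?f (real k)) - (\<Sum>k<K. ?d k) / 2"
    by (subst sum_subtractf) (simp only: sum_divide_distrib)
  finally have main: "M * profile_integral m + (\<Sum>k<K. ?d k) / 2 \<le> (\<Sum>k<K. ?f (real k))"
    using integral_antimono_le_half_sum(2)[of ?f K] anti int by simp
  have d_nonneg: "0 \<le> ?d k" for k
    using anti[of "real k" "real k + 1 / 2"] by simp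
  \<comment> \<open>Half of each drop is gained, hence \<open>512 = 2 * 256\<close>. If
    \<open>M \<le> 8\<close>, a half step has length at least 1/16 in the variable of the profile,
    and \<open>k = 0\<close> alone gives \<open>(1 / 16)\<^sup>2 = 1 / 256\<close>. Otherwise at
    least \<open>M / 8\<close> indices contribute \<open>1 / (4 * M)\<close> each, which gives 1/32.
    All of this is up to the factor \<open>2 ^ m\<close>.\<close>
  have "1 / (256 * 2 ^ m) \<le> (\<Sum>k<K. ?d k)"
  proof (cases "M \<le> 8")
    case True
    have "K > 0"
      using M by (cases K) auto
    have "1 / (256 * 2 ^ m) \<le> ball_profile m 0 - ball_profile m (1 / 16)"
      using ball_profile_decrease[OF m, of 0 "1 / 16"] by (simp add: power2_eq_square)
    also have "\<dots> \<le> ?d 0"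
      using ball_profile_antimono[of "1 / 16" "1 / 2 / M" m] M True by (simp add: field_simps)
    also have "\<dots> \<le> (\<Sum>k<K. ?d k)"
      using \<open>K > 0\<close> d_nonneg by (intro member_le_sum) auto
    finally show ?thesis .
  next
    case False
    \<comment> \<open>For these indices the arguments of the profile lie between 1/4 and 9/16: far
      enough from 0 for a definite slope, and within the range of
      \<open>ball_profile_decrease\<close>.\<close>
    define S where "S = {nat \<lceil>M / 4\<rceil>..nat \<lfloor>M / 2\<rfloor>}"
    have S: "M / 4 \<le> real k" "real k \<le> M / 2" if "k \<in> S" for k
      using that False by (auto simp: S_def nat_le_iff le_nat_iff le_floor_iff ceiling_le_iff)
    have "M / 4 - 1 \<le> real (card S)"
    proof -
      have "real (nat \<lceil>M / 4\<rceil>) \<le> M / 4 + 1" "M / 2 - 1 \<le> real (nat \<lfloor>M / 2\<rfloor>)"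
        using False by linarith+
      moreover have "real (nat \<lfloor>M / 2\<rfloor>) + 1 - real (nat \<lceil>M / 4\<rceil>) \<le> real (card S)"
        by (simp add: S_def)
      ultimately show ?thesis
        by linarith
    qed
    then have card: "M / 8 \<le> real (card S)"
      using False by simp
    have "1 / (256 * 2 ^ m) \<le> 1 / (32 * (2::real) ^ m)"
      by (intro divide_left_mono) auto
    also have "\<dots> = M / 8 * (1 / (4 * M) / 2 ^ m)"
      using M by simp
    also have "\<dots> \<le> real (card S) * (1 / (4 * M) / 2 ^ m)"
      using card M by (intro mult_right_mono) auto
    also have "\<dots> = (\<Sum>k\<in>S. 1 / (4 * M) / 2 ^ m)"
      by simp
    also have "\<dots> \<le> (\<Sum>k\<in>S. ?d k)"
    proof (rule sum_mono)
      fix k assume k: "k \<in> S"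
      let ?x = "real k / M" and ?y = "(real k + 1 / 2) / M"
      have "1 / 2 \<le> ?x + ?y" "?y - ?x = 1 / (2 * M)" "?y \<le> 3 / 4"
        using S[OF k] M False by (auto simp: field_simps)
      then have "1 / (2 * M) * (1 / 2) \<le> (?y - ?x) * (?x + ?y)"
        using M by (intro mult_mono) auto
      also have "\<dots> = ?y\<^sup>2 - ?x\<^sup>2"
        by (simp add: algebra_simps power2_eq_square)
      finally have "1 / (4 * M) / 2 ^ m \<le> (?y\<^sup>2 - ?x\<^sup>2) / 2 ^ m"
        by (intro divide_right_mono) auto
      also have "\<dots> \<le> ?d k"
        using M \<open>?y \<le> 3 / 4\<close> by (intro ball_profile_decrease[OF m]) (auto simp: divide_right_mono)
      finally show "1 / (4 * M) / 2 ^ m \<le> ?d k" .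
    qed
    also have "\<dots> \<le> (\<Sum>k<K. ?d k)"
    proof (rule sum_mono2)
      show "S \<subseteq> {..<K}"
      proof
        fix k assume "k \<in> S"
        then have "real k < real K"
          using S(2)[of k] M by linarith
        then show "k \<in> {..<K}"
          by simp
      qed
    qed (use d_nonneg in auto)
    finally show ?thesis .
  qed
  then have "1 / (512 * 2 ^ m) \<le> (\<Sum>k<K. ?d k) / 2"
    by simp
  with main show ?thesis
    by linarith
qed

subsection \<open>Lattice points in ellipsoids\<close>

text \<open>One notion for both countings: \<open>I\<close> is \<open>\<nat>\<close> or
  \<open>\<int>\<close> as a set of reals, and \<open>A\<close> varies so that coordinate sections
  are covered. The squared radius \<open>\<tau>\<close> may be negative; the count is then 0, also
  for \<open>A = {}\<close>, so slices that miss the ellipsoid fit into the same recursion.\<close>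

definition lattice_points :: "real set \<Rightarrow> nat set \<Rightarrow> (nat \<Rightarrow> real) \<Rightarrow> real \<Rightarrow> (nat \<Rightarrow> real) set" where
  "lattice_points I A a \<tau> = {x \<in> A \<rightarrow>\<^sub>E I. (\<Sum>j\<in>A. (x j)\<^sup>2 / (a j)\<^sup>2) \<le> \<tau>}"

definition lattice_count :: "real set \<Rightarrow> nat set \<Rightarrow> (nat \<Rightarrow> real) \<Rightarrow> real \<Rightarrow> nat" where
  "lattice_count I A a \<tau> = card (lattice_points I A a \<tau>)"

lemma finite_lattice_points:
  assumes "finite A" and pos: "\<And>j. j \<in> A \<Longrightarrow> 0 < a j" and I: "I \<subseteq> \<int>"
  shows "finite (lattice_points I A a \<tau>)"
proof (rule finite_subset)
  let ?B = "\<lambda>j. {k \<in> \<int>. - (a j * sqrt \<tau>) \<le> k \<and> k \<le> a j * sqrt \<tau>}"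
  show "finite (PiE A ?B)"
    using assms(1) by (intro finite_PiE finite_int_segment)
  show "lattice_points I A a \<tau> \<subseteq> PiE A ?B"
  proof
    fix x assume x: "x \<in> lattice_points I A a \<tau>"
    have "x j \<in> ?B j" if j: "j \<in> A" for j
    proof -
      have "(x j)\<^sup>2 / (a j)\<^sup>2 \<le> (\<Sum>j\<in>A. (x j)\<^sup>2 / (a j)\<^sup>2)"
        using assms(1) j by (intro member_le_sum) auto
      also have "\<dots> \<le> \<tau>"
        using x by (simp add: lattice_points_def)
      finally have "sqrt ((x j / a j)\<^sup>2) \<le> sqrt \<tau>"
        unfolding power_divide by (rule real_sqrt_le_mono)
      then have "\<bar>x j / a j\<bar> \<le> sqrt \<tau>"
        by (simp only: real_sqrt_abs)
      then have "\<bar>x j\<bar> \<le> a j * sqrt \<tau>"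
        using pos[OF j] by (simp add: field_simps)
      moreover have "x j \<in> \<int>"
        using x j I by (auto simp: lattice_points_def PiE_def Pi_def)
      ultimately show ?thesis
        by auto
    qed
    with x show "x \<in> PiE A ?B"
      by (auto simp: lattice_points_def PiE_def Pi_def)
  qed
qed

text \<open>\<open>X\<close> may contain heights outside the ellipsoid, since their slices are
  empty. This freedom permits sums over \<open>k < K\<close> for any sufficiently large
  \<open>K\<close>.\<close>

lemma lattice_count_insert:
  assumes "finite A" "j \<notin> A" and pos: "\<And>i. i \<in> insert j A \<Longrightarrow> 0 < a i" and I: "I \<subseteq> \<int>"
    and X: "finite X" "X \<subseteq> I" "\<And>x. x \<in> I \<Longrightarrow> x\<^sup>2 / (a j)\<^sup>2 \<le> \<tau> \<Longrightarrow> x \<in> X"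
  shows "lattice_count I (insert j A) a \<tau> = (\<Sum>x\<in>X. lattice_count I A a (\<tau> - x\<^sup>2 / (a j)\<^sup>2))"
proof -
  let ?S = "SIGMA x:X. lattice_points I A a (\<tau> - x\<^sup>2 / (a j)\<^sup>2)"
  let ?h = "\<lambda>(y, g). g(j := y)"
  have upd: "(\<Sum>i\<in>insert j A. ((g(j := y)) i)\<^sup>2 / (a i)\<^sup>2) = y\<^sup>2 / (a j)\<^sup>2 + (\<Sum>i\<in>A. (g i)\<^sup>2 / (a i)\<^sup>2)"
    for y and g :: "nat \<Rightarrow> real"
  proof -
    have "(\<Sum>i\<in>A. ((g(j := y)) i)\<^sup>2 / (a i)\<^sup>2) = (\<Sum>i\<in>A. (g i)\<^sup>2 / (a i)\<^sup>2)"
      using assms(2) by (intro sum.cong) auto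
    then show ?thesis
      using assms(1,2) by simp
  qed
  have "lattice_points I (insert j A) a \<tau> = ?h ` ?S"
  proof (intro equalityI subsetI)
    fix x assume x: "x \<in> lattice_points I (insert j A) a \<tau>"
    then obtain y g where yg: "y \<in> I" "g \<in> A \<rightarrow>\<^sub>E I" "x = g(j := y)"
      by (auto simp: lattice_points_def PiE_insert_eq)
    with x have le: "y\<^sup>2 / (a j)\<^sup>2 + (\<Sum>i\<in>A. (g i)\<^sup>2 / (a i)\<^sup>2) \<le> \<tau>"
      using upd[of g y] by (simp add: lattice_points_def)
    moreover have "0 \<le> (\<Sum>i\<in>A. (g i)\<^sup>2 / (a i)\<^sup>2)"
      by (intro sum_nonneg) auto
    ultimately have "y \<in> X"
      using X(3)[OF yg(1)] by linarith
    with yg le show "x \<in> ?h ` ?S"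
      by (auto simp: lattice_points_def intro!: image_eqI[of _ _ "(y, g)"])
  next
    fix x assume "x \<in> ?h ` ?S"
    then obtain y g where yg: "y \<in> X" "g \<in> lattice_points I A a (\<tau> - y\<^sup>2 / (a j)\<^sup>2)" "x = g(j := y)"
      by auto
    then show "x \<in> lattice_points I (insert j A) a \<tau>"
      using upd[of g y] X(2) by (auto simp: lattice_points_def PiE_insert_eq)
  qed
  moreover have "inj_on ?h ?S"
    by (rule inj_on_subset[OF inj_combinator[OF assms(2), of "\<lambda>_. I"]])
       (use X(2) in \<open>auto simp: lattice_points_def\<close>)
  ultimately have "lattice_count I (insert j A) a \<tau> = card ?S"
    by (simp add: lattice_count_def card_image)
  also have "\<dots> = (\<Sum>x\<in>X. lattice_count I A a (\<tau> - x\<^sup>2 / (a j)\<^sup>2))"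
    unfolding lattice_count_def
    using X(1) assms(1) pos I by (intro card_SigmaI) (auto intro!: finite_lattice_points)
  finally show ?thesis .
qed

lemma lattice_count_empty: "0 \<le> \<tau> \<Longrightarrow> lattice_count I {} a \<tau> = 1"
  by (simp add: lattice_count_def lattice_points_def)

lemma lattice_count_neg: "\<tau> < 0 \<Longrightarrow> lattice_count I A a \<tau> = 0"
proof -
  assume "\<tau> < 0"
  have "\<not> (\<Sum>j\<in>A. (x j)\<^sup>2 / (a j)\<^sup>2) \<le> \<tau>" for x
    using sum_nonneg[of A "\<lambda>j. (x j)\<^sup>2 / (a j)\<^sup>2"] \<open>\<tau> < 0\<close> by simp
  then show ?thesis
    by (simp add: lattice_count_def lattice_points_def)
qed

lemma lattice_count_mono:
  assumes "finite A" "\<And>j. j \<in> A \<Longrightarrow> 0 < a j" "I \<subseteq> \<int>" "\<tau> \<le> \<tau>'"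
  shows "lattice_count I A a \<tau> \<le> lattice_count I A a \<tau>'"
  unfolding lattice_count_def
  using assms by (intro card_mono finite_lattice_points) (auto simp: lattice_points_def)

lemma slice_outside:
  assumes "0 < (b::real)" "b * sqrt \<tau> < x"
  shows "\<tau> < x\<^sup>2 / b\<^sup>2"
proof (cases "0 \<le> \<tau>")
  case True
  then have "0 \<le> b * sqrt \<tau>"
    using assms(1) by simp
  then have "(b * sqrt \<tau>)\<^sup>2 < x\<^sup>2"
    using assms(2) by (intro power_strict_mono) auto
  then show ?thesis
    using True assms(1) by (simp add: power_mult_distrib field_simps)
next
  case False
  have "0 \<le> x\<^sup>2 / b\<^sup>2"
    by simp
  with False show ?thesis
    by linarith
qed

lemma lattice_count_Nats_insert:
  assumes "finite A" "j \<notin> A" and pos: "\<And>i. i \<in> insert j A \<Longrightarrow> 0 < a i"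
    and K: "a j * sqrt \<tau> < real K"
  shows "lattice_count \<nat> (insert j A) a \<tau> = (\<Sum>k<K. lattice_count \<nat> A a (\<tau> - (real k)\<^sup>2 / (a j)\<^sup>2))"
proof -
  have "lattice_count \<nat> (insert j A) a \<tau>
      = (\<Sum>x\<in>real ` {..<K}. lattice_count \<nat> A a (\<tau> - x\<^sup>2 / (a j)\<^sup>2))"
  proof (rule lattice_count_insert)
    fix x :: real assume x: "x \<in> \<nat>" "x\<^sup>2 / (a j)\<^sup>2 \<le> \<tau>"
    then obtain k where k: "x = real k"
      by (auto elim: Nats_cases)
    have "k < K"
    proof (rule ccontr)
      assume "\<not> k < K"
      then have "a j * sqrt \<tau> < x"
        using K k by simp
      with slice_outside[of "a j" \<tau> x] x(2) pos show False
        by simp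
    qed
    then show "x \<in> real ` {..<K}"
      using k by auto
  qed (use assms in \<open>auto simp: Nats_subset_Ints\<close>)
  then show ?thesis
    by (simp add: sum.reindex inj_on_def)
qed

text \<open>Heights \<open>k\<close> and \<open>- k\<close> carry the same slice, but height 0
  occurs only once; a second copy of the central slice restores the symmetry. In this form the
  identity is the inductive step of \<open>lattice_count_Nats_eq_sum\<close>.\<close>

lemma lattice_count_Ints_insert:
  assumes "finite A" "j \<notin> A" and pos: "\<And>i. i \<in> insert j A \<Longrightarrow> 0 < a i"
    and K: "a j * sqrt \<tau> < real K" "0 < K"
  shows "lattice_count \<int> (insert j A) a \<tau> + lattice_count \<int> A a \<tau>
      = 2 * (\<Sum>k<K. lattice_count \<int> A a (\<tau> - (real k)\<^sup>2 / (a j)\<^sup>2))"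
proof -
  let ?F = "\<lambda>x. lattice_count \<int> A a (\<tau> - x\<^sup>2 / (a j)\<^sup>2)"
  let ?X = "real ` {..<K}" and ?Y = "(\<lambda>k. - real k) ` {0<..<K}"
  have "lattice_count \<int> (insert j A) a \<tau> = (\<Sum>x\<in>?X \<union> ?Y. ?F x)"
  proof (rule lattice_count_insert)
    fix x :: real assume x: "x \<in> \<int>" "x\<^sup>2 / (a j)\<^sup>2 \<le> \<tau>"
    then obtain z where z: "x = of_int z"
      by (auto elim: Ints_cases)
    have "\<bar>x\<bar> < real K"
    proof (rule ccontr)
      assume "\<not> \<bar>x\<bar> < real K"
      then have "a j * sqrt \<tau> < \<bar>x\<bar>"
        using K by simp
      with slice_outside[of "a j" \<tau> "\<bar>x\<bar>"] x(2) pos show False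
        by simp
    qed
    then have "\<bar>z\<bar> < int K"
      using z by linarith
    show "x \<in> ?X \<union> ?Y"
    proof (cases "0 \<le> z")
      case True
      then have "x = real (nat z)" "nat z < K"
        using z \<open>\<bar>z\<bar> < int K\<close> by auto
      then show ?thesis
        by blast
    next
      case False
      then have "x = - real (nat (- z))" "nat (- z) \<in> {0<..<K}"
        using z \<open>\<bar>z\<bar> < int K\<close> by auto
      then show ?thesis
        by blast
    qed
  qed (use assms in \<open>auto simp: Nats_subset_Ints\<close>)
  also have "\<dots> = (\<Sum>x\<in>?X. ?F x) + (\<Sum>x\<in>?Y. ?F x)"
    by (rule sum.union_disjoint) auto
  also have "(\<Sum>x\<in>?X. ?F x) = (\<Sum>k<K. ?F (real k))"
    by (simp add: sum.reindex inj_on_def)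
  also have "(\<Sum>x\<in>?Y. ?F x) = (\<Sum>k\<in>{0<..<K}. ?F (real k))"
    by (simp add: sum.reindex inj_on_def)
  finally have "lattice_count \<int> (insert j A) a \<tau> = (\<Sum>k<K. ?F (real k)) + (\<Sum>k\<in>{0<..<K}. ?F (real k))" .
  moreover have "(\<Sum>k\<in>{0<..<K}. ?F (real k)) + lattice_count \<int> A a \<tau> = (\<Sum>k<K. ?F (real k))"
  proof -
    have "{..<K} = insert 0 {0<..<K}"
      using K by auto
    then show ?thesis
      by simp
  qed
  ultimately show ?thesis
    by simp
qed

text \<open>\<open>S\<close> collects the coordinates that are not forced to be 0. In one
  coordinate, the sum of an even function over the integers plus its value at 0 is twice its sum
  over the naturals; doing this in every coordinate produces each coordinate section once.\<close>

lemma lattice_count_Nats_eq_sum: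
  assumes "finite A" "\<And>i. i \<in> A \<Longrightarrow> 0 < a i"
  shows "2 ^ card A * lattice_count \<nat> A a \<tau> = (\<Sum>S\<in>Pow A. lattice_count \<int> S a \<tau>)"
  using assms
proof (induction A arbitrary: \<tau>)
  case empty
  then show ?case
    by (simp add: lattice_count_def lattice_points_def)
next
  case (insert j A)
  obtain K where K: "a j * sqrt \<tau> < real K" "0 < K"
    using reals_Archimedean2[of "max 0 (a j * sqrt \<tau>)"] by (auto simp: max_def split: if_splits)
  have inj: "inj_on (insert j) (Pow A)"
    using insert.hyps by (auto simp: inj_on_def)
  have "2 ^ card (insert j A) * lattice_count \<nat> (insert j A) a \<tau>
      = 2 * (\<Sum>k<K. 2 ^ card A * lattice_count \<nat> A a (\<tau> - (real k)\<^sup>2 / (a j)\<^sup>2))"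
    using insert K by (subst lattice_count_Nats_insert[of A j a \<tau> K]) (auto simp: sum_distrib_left mult_ac)
  also have "\<dots> = 2 * (\<Sum>k<K. \<Sum>S\<in>Pow A. lattice_count \<int> S a (\<tau> - (real k)\<^sup>2 / (a j)\<^sup>2))"
    using insert by simp
  also have "\<dots> = (\<Sum>S\<in>Pow A. 2 * (\<Sum>k<K. lattice_count \<int> S a (\<tau> - (real k)\<^sup>2 / (a j)\<^sup>2)))"
    by (subst sum.swap) (simp add: sum_distrib_left)
  also have "\<dots> = (\<Sum>S\<in>Pow A. lattice_count \<int> (insert j S) a \<tau> + lattice_count \<int> S a \<tau>)"
  proof (rule sum.cong)
    fix S assume "S \<in> Pow A"
    then show "2 * (\<Sum>k<K. lattice_count \<int> S a (\<tau> - (real k)\<^sup>2 / (a j)\<^sup>2))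
        = lattice_count \<int> (insert j S) a \<tau> + lattice_count \<int> S a \<tau>"
      using insert K by (intro lattice_count_Ints_insert [symmetric]) (auto intro: finite_subset)
  qed simp
  also have "\<dots> = (\<Sum>S\<in>Pow (insert j A). lattice_count \<int> S a \<tau>)"
    unfolding Pow_insert
    by (subst sum.union_disjoint) (use insert.hyps inj in \<open>auto simp: sum.distrib sum.reindex\<close>)
  finally show ?case .
qed

section \<open>Lower bounds for non-negative lattice points\<close>

definition orthant_vol :: "nat \<Rightarrow> real" where
  "orthant_vol m = unit_ball_vol (real m) / 2 ^ m"

lemma orthant_vol_pos: "0 < orthant_vol m"
  by (simp add: orthant_vol_def)

lemma orthant_vol_0: "orthant_vol 0 = 1"
  by (simp add: orthant_vol_def unit_ball_vol_def)

lemma orthant_vol_Suc: "orthant_vol (Suc m) = orthant_vol m * profile_integral m"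
  by (simp add: orthant_vol_def unit_ball_vol_Suc del: of_nat_Suc)

lemma slice_inside:
  assumes "0 < b" "0 < \<tau>" "0 \<le> x" "x \<le> b * sqrt \<tau>"
  shows "0 \<le> \<tau> - x\<^sup>2 / b\<^sup>2"
    and "sqrt (\<tau> - x\<^sup>2 / b\<^sup>2) ^ m = sqrt \<tau> ^ m * ball_profile m (x / (b * sqrt \<tau>))"
proof -
  let ?y = "x / (b * sqrt \<tau>)"
  have eq: "\<tau> - x\<^sup>2 / b\<^sup>2 = \<tau> * (1 - ?y\<^sup>2)"
    using assms by (simp add: power_divide power_mult_distrib field_simps)
  have y: "0 \<le> ?y" "?y \<le> 1"
    using assms by (auto simp: divide_le_eq)
  then have "?y\<^sup>2 \<le> 1"
    by (simp add: power_le_one)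
  then show "0 \<le> \<tau> - x\<^sup>2 / b\<^sup>2"
    using assms by (simp add: eq)
  show "sqrt (\<tau> - x\<^sup>2 / b\<^sup>2) ^ m = sqrt \<tau> ^ m * ball_profile m (x / (b * sqrt \<tau>))"
    using y(2) by (simp add: eq real_sqrt_mult power_mult_distrib ball_profile_def)
qed

text \<open>\<open>N\<close> stands for the count in the remaining coordinates. Beyond the ellipsoid
  the left-hand terms vanish by the cut-off of the profile, so \<open>K\<close> is
  arbitrary.\<close>

lemma slice_sum_lower:
  assumes "0 < b" "0 < \<tau>" "0 \<le> c"
    and N: "\<And>\<sigma>. 0 \<le> \<sigma> \<Longrightarrow> c * sqrt \<sigma> ^ m \<le> N \<sigma>" "\<And>\<sigma>. 0 \<le> N \<sigma>"
  shows "c * sqrt \<tau> ^ m * (\<Sum>k<K. ball_profile m (real k / (b * sqrt \<tau>)))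
      \<le> (\<Sum>k<K. N (\<tau> - (real k)\<^sup>2 / b\<^sup>2))"
  unfolding sum_distrib_left
proof (rule sum_mono)
  fix k assume "k \<in> {..<K}"
  show "c * sqrt \<tau> ^ m * ball_profile m (real k / (b * sqrt \<tau>)) \<le> N (\<tau> - (real k)\<^sup>2 / b\<^sup>2)"
  proof (cases "real k \<le> b * sqrt \<tau>")
    case True
    then show ?thesis
      using slice_inside[of b \<tau> "real k"] N(1)[of "\<tau> - (real k)\<^sup>2 / b\<^sup>2"] assms
      by (simp add: mult.assoc)
  next
    case False
    then have "ball_profile m (real k / (b * sqrt \<tau>)) = 0"
      using assms by (auto simp: ball_profile_def divide_le_eq)
    then show ?thesis
      using N(2) by simp
  qed
qed

text \<open>Geometrically, the unit cubes erected outwards at the counted points cover the positive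
  orthant of the ellipsoid, so the Weyl term is a lower bound without error, however thin the
  cuboid. The proof by slices has the advantage that one of its steps can be sharpened, as in
  \<open>lattice_count_Nats_lower_gap\<close>.\<close>

lemma lattice_count_Nats_lower:
  assumes "finite A" "\<And>j. j \<in> A \<Longrightarrow> 0 < a j" "0 \<le> \<tau>"
  shows "orthant_vol (card A) * (\<Prod>j\<in>A. a j) * sqrt \<tau> ^ card A \<le> lattice_count \<nat> A a \<tau>"
  using assms
proof (induction A arbitrary: \<tau>)
  case empty
  then show ?case
    by (simp add: orthant_vol_0 lattice_count_empty)
next
  case (insert j A)
  show ?case
  proof (cases "\<tau> = 0")
    case True
    then show ?thesis
      using insert by simp
  next
    case False
    then have \<tau>: "0 < \<tau>"
      using insert by simp
    let ?M = "a j * sqrt \<tau>" and ?c = "orthant_vol (card A) * (\<Prod>j\<in>A. a j)"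
    have j: "0 < a j"
      using insert by simp
    obtain K where K: "?M < real K"
      using reals_Archimedean2 by blast
    have "0 \<le> ?c"
      using orthant_vol_pos[of "card A"] insert by (intro mult_nonneg_nonneg prod_nonneg) (auto intro: less_imp_le)
    have "orthant_vol (card (insert j A)) * (\<Prod>j\<in>insert j A. a j) * sqrt \<tau> ^ card (insert j A)
        = ?c * sqrt \<tau> ^ card A * (?M * profile_integral (card A))"
      using insert.hyps by (simp add: orthant_vol_Suc)
    also have "\<dots> \<le> ?c * sqrt \<tau> ^ card A * (\<Sum>k<K. ball_profile (card A) (real k / ?M))"
      using j \<tau> K \<open>0 \<le> ?c\<close> by (intro mult_left_mono sum_ball_profile_bounds) auto
    also have "\<dots> \<le> (\<Sum>k<K. real (lattice_count \<nat> A a (\<tau> - (real k)\<^sup>2 / (a j)\<^sup>2)))"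
      using insert \<open>0 \<le> ?c\<close> j \<tau> by (intro slice_sum_lower) auto
    also have "\<dots> = lattice_count \<nat> (insert j A) a \<tau>"
      using lattice_count_Nats_insert[of A j a \<tau> K] insert K by simp
    finally show ?thesis .
  qed
qed

text \<open>Since the prefactor of the gap does not contain \<open>a j\<close>, this rules out thin minimisers.\<close>

lemma lattice_count_Nats_lower_gap:
  assumes "finite A" "A \<noteq> {}" "j \<notin> A" and pos: "\<And>i. i \<in> insert j A \<Longrightarrow> 0 < a i" and \<tau>: "0 \<le> \<tau>"
  shows "orthant_vol (card A + 1) * (\<Prod>i\<in>insert j A. a i) * sqrt \<tau> ^ (card A + 1)
      + orthant_vol (card A) / (512 * 2 ^ card A) * (\<Prod>i\<in>A. a i) * sqrt \<tau> ^ card A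
      \<le> lattice_count \<nat> (insert j A) a \<tau>"
proof (cases "\<tau> = 0")
  case True
  then show ?thesis
    using assms by (simp add: zero_power card_gt_0_iff)
next
  case False
  then have \<tau>: "0 < \<tau>"
    using assms by simp
  let ?M = "a j * sqrt \<tau>" and ?c = "orthant_vol (card A) * (\<Prod>j\<in>A. a j)"
  have j: "0 < a j"
    using assms by simp
  obtain K where K: "?M < real K"
    using reals_Archimedean2 by blast
  have "0 \<le> ?c"
    using orthant_vol_pos[of "card A"] pos by (intro mult_nonneg_nonneg prod_nonneg) (auto intro: less_imp_le)
  have "card A \<ge> 1"
    using assms by (simp add: Suc_le_eq card_gt_0_iff)
  have "orthant_vol (card A + 1) * (\<Prod>i\<in>insert j A. a i) * sqrt \<tau> ^ (card A + 1)
      + orthant_vol (card A) / (512 * 2 ^ card A) * (\<Prod>i\<in>A. a i) * sqrt \<tau> ^ card A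
      = ?c * sqrt \<tau> ^ card A * (?M * profile_integral (card A) + 1 / (512 * 2 ^ card A))"
    using assms by (simp add: orthant_vol_Suc algebra_simps)
  also have "\<dots> \<le> ?c * sqrt \<tau> ^ card A * (\<Sum>k<K. ball_profile (card A) (real k / ?M))"
    using j \<tau> K \<open>0 \<le> ?c\<close> \<open>card A \<ge> 1\<close> by (intro mult_left_mono sum_ball_profile_gap) auto
  also have "\<dots> \<le> (\<Sum>k<K. real (lattice_count \<nat> A a (\<tau> - (real k)\<^sup>2 / (a j)\<^sup>2)))"
    using assms \<open>0 \<le> ?c\<close> j \<tau> by (intro slice_sum_lower lattice_count_Nats_lower) auto
  also have "\<dots> = lattice_count \<nat> (insert j A) a \<tau>"
    using lattice_count_Nats_insert[of A j a \<tau> K] assms K by simp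
  finally show ?thesis .
qed

section \<open>Integer points: volume term with an elementary error\<close>

definition ellipsoid_vol :: "nat set \<Rightarrow> (nat \<Rightarrow> real) \<Rightarrow> real" where
  "ellipsoid_vol A a = unit_ball_vol (real (card A)) * (\<Prod>i\<in>A. a i)"

lemma ellipsoid_vol_nonneg: "(\<And>j. j \<in> A \<Longrightarrow> 0 < a j) \<Longrightarrow> 0 \<le> ellipsoid_vol A a"
  unfolding ellipsoid_vol_def by (intro mult_nonneg_nonneg prod_nonneg) (auto intro: less_imp_le)

text \<open>The factor \<open>card A\<close> in the error bound expresses that there is no error in dimension \<open>0\<close>.\<close>

lemma lattice_count_Ints_asymp:
  assumes "finite A" "0 < u"
  shows "\<exists>C\<ge>0. \<forall>a\<in>A \<rightarrow> {0<..u}. \<forall>\<tau>\<ge>0.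
    \<bar>real (lattice_count \<int> A a \<tau>) - ellipsoid_vol A a * sqrt \<tau> ^ card A\<bar>
      \<le> C * real (card A) * (1 + sqrt \<tau>) ^ (card A - 1)"
  using assms(1)
proof (induction A)
  case empty
  show ?case
    by (intro exI[of _ 0]) (auto simp: lattice_count_empty ellipsoid_vol_def unit_ball_vol_def)
next
  case (insert j A)
  let ?m = "card A"
  obtain C where C: "C \<ge> 0" and C_bound: "\<And>a \<tau>. a \<in> A \<rightarrow> {0<..u} \<Longrightarrow> \<tau> \<ge> 0 \<Longrightarrow>
    \<bar>real (lattice_count \<int> A a \<tau>) - ellipsoid_vol A a * sqrt \<tau> ^ ?m\<bar>
      \<le> C * real ?m * (1 + sqrt \<tau>) ^ (?m - 1)"
    using insert.IH by blast
  define \<omega> where "\<omega> = unit_ball_vol (real ?m)"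
  have \<omega>: "0 < \<omega>"
    by (simp add: \<omega>_def)
  \<comment> \<open>One summand for each source of error: the slices, at most
    \<open>(u + 1) * (1 + sqrt \<tau>)\<close> in number and counted twice; the subtracted central
    slice; the Riemann sum; and 1 for \<open>\<tau> = 0\<close>, where only the origin is counted
    and the volume term vanishes.\<close>
  define C' where "C' = 2 * (u + 1) * C * real ?m + C * real ?m + \<omega> * u ^ ?m + 1"
  have "0 \<le> C'"
    using C \<omega> assms by (simp add: C'_def)
  have main: "\<bar>real (lattice_count \<int> (insert j A) a \<tau>)
      - ellipsoid_vol (insert j A) a * sqrt \<tau> ^ Suc ?m\<bar> \<le> C' * (1 + sqrt \<tau>) ^ ?m"
    if a: "a \<in> insert j A \<rightarrow> {0<..u}" and \<tau>: "\<tau> > 0" for a \<tau>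
  proof -
    let ?M = "a j * sqrt \<tau>" and ?V = "ellipsoid_vol A a"
    let ?E = "C * real ?m * (1 + sqrt \<tau>) ^ (?m - 1)"
    let ?\<sigma> = "\<lambda>k. \<tau> - (real k)\<^sup>2 / (a j)\<^sup>2"
    let ?g = "\<lambda>k. ball_profile ?m (real k / ?M)"
    define K where "K = nat \<lfloor>?M\<rfloor> + 1"
    have pos: "\<And>i. i \<in> insert j A \<Longrightarrow> 0 < a i" and le: "\<And>i. i \<in> insert j A \<Longrightarrow> a i \<le> u"
      using a by (auto simp: Pi_iff)
    have M: "0 < ?M"
      using \<tau> pos by simp
    then have K: "?M < real K" "real K \<le> ?M + 1"
      unfolding K_def by linarith+
    have V: "0 \<le> ?V" "?V \<le> \<omega> * u ^ ?m"
    proof -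
      show "0 \<le> ?V"
        using pos by (intro ellipsoid_vol_nonneg) auto
      have "(\<Prod>i\<in>A. a i) \<le> (\<Prod>i\<in>A. u)"
        using pos le by (intro prod_mono) (auto intro: less_imp_le)
      then show "?V \<le> \<omega> * u ^ ?m"
        using \<omega> by (simp add: ellipsoid_vol_def \<omega>_def)
    qed
    have E: "0 \<le> ?E"
      using C \<tau> by simp
    have slice: "\<bar>real (lattice_count \<int> A a (?\<sigma> k)) - ?V * sqrt \<tau> ^ ?m * ?g k\<bar> \<le> ?E"
      if "k < K" for k
    proof -
      have "real k \<le> ?M"
        using that M unfolding K_def by linarith
      then have \<sigma>: "0 \<le> ?\<sigma> k" "sqrt (?\<sigma> k) ^ ?m = sqrt \<tau> ^ ?m * ?g k"
        using slice_inside[of "a j" \<tau> "real k"] pos \<tau> by auto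
      have "\<bar>real (lattice_count \<int> A a (?\<sigma> k)) - ?V * sqrt (?\<sigma> k) ^ ?m\<bar>
          \<le> C * real ?m * (1 + sqrt (?\<sigma> k)) ^ (?m - 1)"
        using a \<sigma>(1) by (intro C_bound) (auto simp: Pi_iff)
      also have "\<dots> \<le> ?E"
        using C \<sigma>(1) by (intro mult_left_mono power_mono) auto
      finally show ?thesis
        by (simp add: \<sigma>(2) mult.assoc)
    qed
    have sum_err: "\<bar>(\<Sum>k<K. real (lattice_count \<int> A a (?\<sigma> k))) - ?V * sqrt \<tau> ^ ?m * (\<Sum>k<K. ?g k)\<bar>
        \<le> (u + 1) * (C * real ?m * (1 + sqrt \<tau>) ^ ?m)"
    proof -
      have "\<bar>(\<Sum>k<K. real (lattice_count \<int> A a (?\<sigma> k))) - ?V * sqrt \<tau> ^ ?m * (\<Sum>k<K. ?g k)\<bar>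
          \<le> (\<Sum>k<K. \<bar>real (lattice_count \<int> A a (?\<sigma> k)) - ?V * sqrt \<tau> ^ ?m * ?g k\<bar>)"
        unfolding sum_distrib_left sum_subtractf [symmetric] by (rule sum_abs)
      also have "\<dots> \<le> (\<Sum>k<K. ?E)"
        using slice by (intro sum_mono) auto
      also have "\<dots> = real K * ?E"
        by simp
      also have "\<dots> \<le> (u + 1) * (1 + sqrt \<tau>) * ?E"
      proof (rule mult_right_mono[OF _ E])
        have "?M \<le> u * sqrt \<tau>"
          using le \<tau> by (intro mult_right_mono) auto
        then have "real K \<le> u * sqrt \<tau> + 1"
          using K(2) by linarith
        also have "\<dots> \<le> (u + 1) * (1 + sqrt \<tau>)"
          using assms(2) \<tau> by (simp add: algebra_simps)
        finally show "real K \<le> (u + 1) * (1 + sqrt \<tau>)" .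
      qed
      \<comment> \<open>For \<open>?m = 0\<close> truncated subtraction breaks the addition of
        exponents, but there the factor \<open>real ?m\<close> makes both sides 0.\<close>
      also have "\<dots> = (u + 1) * (C * real ?m * (1 + sqrt \<tau>) ^ ?m)"
        by (cases ?m) auto
      finally show ?thesis .
    qed
    \<comment> \<open>The sum exceeds the integral by an amount between 0 and 1. The
      \<open>- 1\<close> is the leading part of the central slice subtracted in \<open>rec\<close>,
      and it centres the error of the doubled sum.\<close>
    have g_sum: "\<bar>2 * (\<Sum>k<K. ?g k) - 1 - 2 * ?M * profile_integral ?m\<bar> \<le> 1"
      using sum_ball_profile_bounds[of ?M K ?m] M K by auto
    have vol: "ellipsoid_vol (insert j A) a * sqrt \<tau> ^ Suc ?m
        = ?V * sqrt \<tau> ^ ?m * (2 * ?M * profile_integral ?m)"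
      using insert.hyps by (simp add: ellipsoid_vol_def unit_ball_vol_Suc algebra_simps del: of_nat_Suc)
    have low: "\<bar>real (lattice_count \<int> A a \<tau>) - ?V * sqrt \<tau> ^ ?m\<bar> \<le> C * real ?m * (1 + sqrt \<tau>) ^ ?m"
    proof -
      have "\<bar>real (lattice_count \<int> A a \<tau>) - ?V * sqrt \<tau> ^ ?m\<bar> \<le> ?E"
        using a \<tau> by (intro C_bound) (auto simp: Pi_iff)
      also have "\<dots> \<le> C * real ?m * (1 + sqrt \<tau>) ^ ?m"
        using C \<tau> by (intro mult_left_mono power_increasing) auto
      finally show ?thesis .
    qed
    have rec: "real (lattice_count \<int> (insert j A) a \<tau>)
        = 2 * (\<Sum>k<K. real (lattice_count \<int> A a (?\<sigma> k))) - real (lattice_count \<int> A a \<tau>)"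
    proof -
      have "lattice_count \<int> (insert j A) a \<tau> + lattice_count \<int> A a \<tau>
          = 2 * (\<Sum>k<K. lattice_count \<int> A a (?\<sigma> k))"
        using insert.hyps pos K(1) by (intro lattice_count_Ints_insert) (auto simp: K_def)
      then have "real (lattice_count \<int> (insert j A) a \<tau> + lattice_count \<int> A a \<tau>)
          = real (2 * (\<Sum>k<K. lattice_count \<int> A a (?\<sigma> k)))"
        by simp
      then show ?thesis
        by simp
    qed
    define X where "X = (\<Sum>k<K. real (lattice_count \<int> A a (?\<sigma> k))) - ?V * sqrt \<tau> ^ ?m * (\<Sum>k<K. ?g k)"
    define Y where "Y = real (lattice_count \<int> A a \<tau>) - ?V * sqrt \<tau> ^ ?m"
    define Z where "Z = 2 * (\<Sum>k<K. ?g k) - 1 - 2 * ?M * profile_integral ?m"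
    have "real (lattice_count \<int> (insert j A) a \<tau>) - ellipsoid_vol (insert j A) a * sqrt \<tau> ^ Suc ?m
        = 2 * X - Y + ?V * sqrt \<tau> ^ ?m * Z"
      unfolding rec vol X_def Y_def Z_def by (simp add: algebra_simps)
    moreover have "\<bar>?V * sqrt \<tau> ^ ?m * Z\<bar> \<le> \<omega> * u ^ ?m * (1 + sqrt \<tau>) ^ ?m"
    proof -
      have "\<bar>?V * sqrt \<tau> ^ ?m * Z\<bar> = ?V * sqrt \<tau> ^ ?m * \<bar>Z\<bar>"
        using V \<tau> by (simp add: abs_mult)
      also have "\<dots> \<le> \<omega> * u ^ ?m * (1 + sqrt \<tau>) ^ ?m * 1"
        using V \<tau> g_sum \<omega> assms(2) unfolding Z_def by (intro mult_mono power_mono) auto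
      finally show ?thesis
        by simp
    qed
    moreover have "\<bar>X\<bar> \<le> (u + 1) * (C * real ?m * (1 + sqrt \<tau>) ^ ?m)"
      unfolding X_def by (rule sum_err)
    moreover have "\<bar>Y\<bar> \<le> C * real ?m * (1 + sqrt \<tau>) ^ ?m"
      unfolding Y_def by (rule low)
    ultimately have "\<bar>real (lattice_count \<int> (insert j A) a \<tau>) - ellipsoid_vol (insert j A) a * sqrt \<tau> ^ Suc ?m\<bar>
        \<le> 2 * ((u + 1) * (C * real ?m * (1 + sqrt \<tau>) ^ ?m)) + C * real ?m * (1 + sqrt \<tau>) ^ ?m
          + \<omega> * u ^ ?m * (1 + sqrt \<tau>) ^ ?m"
      by linarith
    also have "\<dots> \<le> C' * (1 + sqrt \<tau>) ^ ?m"
      using \<tau> by (simp add: C'_def algebra_simps)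
    finally show ?thesis .
  qed
  show ?case
  proof (intro exI[of _ C'] conjI ballI allI impI)
    fix a and \<tau> :: real assume a: "a \<in> insert j A \<rightarrow> {0<..u}" and \<tau>: "0 \<le> \<tau>"
    have "\<bar>real (lattice_count \<int> (insert j A) a \<tau>) - ellipsoid_vol (insert j A) a * sqrt \<tau> ^ Suc ?m\<bar>
        \<le> C' * (1 + sqrt \<tau>) ^ ?m"
    proof (cases "\<tau> = 0")
      case True
      have "lattice_points \<int> (insert j A) a 0 = {restrict (\<lambda>_. 0) (insert j A)}"
      proof -
        have "(\<Sum>i\<in>insert j A. (x i)\<^sup>2 / (a i)\<^sup>2) \<le> 0 \<longleftrightarrow> (\<forall>i\<in>insert j A. x i = 0)" for x
        proof -
          have "0 \<le> (\<Sum>i\<in>insert j A. (x i)\<^sup>2 / (a i)\<^sup>2)"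
            by (intro sum_nonneg) auto
          then have "(\<Sum>i\<in>insert j A. (x i)\<^sup>2 / (a i)\<^sup>2) \<le> 0 \<longleftrightarrow> (\<Sum>i\<in>insert j A. (x i)\<^sup>2 / (a i)\<^sup>2) = 0"
            by linarith
          also have "\<dots> \<longleftrightarrow> (\<forall>i\<in>insert j A. (x i)\<^sup>2 / (a i)\<^sup>2 = 0)"
            using insert.hyps(1) by (intro sum_nonneg_eq_0_iff) auto
          also have "\<dots> \<longleftrightarrow> (\<forall>i\<in>insert j A. x i = 0)"
            using a by (intro ball_cong) (fastforce simp: Pi_iff)+
          finally show ?thesis .
        qed
        then show ?thesis
          unfolding lattice_points_def by (auto simp: PiE_def extensional_def fun_eq_iff)
      qed
      then have "lattice_count \<int> (insert j A) a \<tau> = 1"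
        by (simp add: lattice_count_def True)
      then show ?thesis
        using True C \<omega> assms(2) by (simp add: C'_def)
    next
      case False
      then show ?thesis
        using main a \<tau> by simp
    qed
    also have "\<dots> \<le> C' * real (Suc ?m) * (1 + sqrt \<tau>) ^ ?m"
      using \<open>0 \<le> C'\<close> \<tau> by (intro mult_right_mono) (auto simp: distrib_left)
    finally show "\<bar>real (lattice_count \<int> (insert j A) a \<tau>)
        - ellipsoid_vol (insert j A) a * sqrt \<tau> ^ card (insert j A)\<bar>
      \<le> C' * real (card (insert j A)) * (1 + sqrt \<tau>) ^ (card (insert j A) - 1)"
      using insert.hyps by simp
  qed (use \<open>0 \<le> C'\<close> in auto)
qed

subsection \<open>Riesz means as integrals of counting functions\<close>

text \<open>If the count at \<open>s\<close> is at most \<open>k\<close>, it stays so up to the next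
  value of \<open>f\<close>, which lies strictly above \<open>s\<close> because sublevel sets are
  finite; hence the infimum exceeds \<open>s\<close>. That \<open>X\<close> is infinite makes the
  set under \<open>Inf\<close> non-empty.\<close>

lemma Inf_counting_le_iff:
  fixes f :: "'a \<Rightarrow> real"
  assumes fin: "\<And>l. finite {i \<in> X. f i \<le> l}" and inf: "infinite X"
    and nonneg: "\<And>i. i \<in> X \<Longrightarrow> 0 \<le> f i"
  shows "Inf {l. k < card {i \<in> X. f i \<le> l}} \<le> s \<longleftrightarrow> k < card {i \<in> X. f i \<le> s}"
proof
  let ?c = "\<lambda>l. card {i \<in> X. f i \<le> l}"
  let ?L = "{l. k < ?c l}"
  have mono: "?c l \<le> ?c l'" if "l \<le> l'" for l l'
    using that by (intro card_mono fin) auto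
  have "0 \<le> l" if "l \<in> ?L" for l
  proof -
    have "{i \<in> X. f i \<le> l} \<noteq> {}"
      using that by (auto simp del: Collect_empty_eq)
    then show ?thesis
      using nonneg by fastforce
  qed
  then have bdd: "bdd_below ?L"
    by (rule bdd_belowI)
  show "Inf ?L \<le> s" if "k < ?c s"
    using that bdd by (intro cInf_lower) auto
  show "k < ?c s" if le: "Inf ?L \<le> s"
  proof (rule ccontr)
    assume not: "\<not> k < ?c s"
    let ?T = "{i \<in> X. f i \<le> s + 1} - {i \<in> X. f i \<le> s}"
    obtain Y where Y: "Y \<subseteq> X" "finite Y" "card Y = Suc k"
      using infinite_arbitrarily_large[OF inf] by metis
    have "Suc k \<le> ?c (Max (f ` Y))"
      unfolding Y(3) [symmetric] using Y by (intro card_mono fin) auto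
    then have "Max (f ` Y) \<in> ?L"
      by simp
    then have "?L \<noteq> {}"
      by blast
    \<comment> \<open>The next value of \<open>f\<close> above \<open>s\<close>; the cap
      \<open>s + 1\<close> makes the minimum range over a non-empty set.\<close>
    define s' where "s' = Min (insert (s + 1) (f ` ?T))"
    have "finite ?T"
      using fin by simp
    then have s': "s < s'"
      unfolding s'_def by (subst Min_gr_iff) auto
    have "s' \<le> l" if l: "l \<in> ?L" for l
    proof (rule ccontr)
      assume "\<not> s' \<le> l"
      have "{i \<in> X. f i \<le> l} \<subseteq> {i \<in> X. f i \<le> s}"
      proof (intro subsetI, rule ccontr)
        fix i assume i: "i \<in> {i \<in> X. f i \<le> l}" "i \<notin> {i \<in> X. f i \<le> s}"
        have "s' \<le> s + 1"
          unfolding s'_def using \<open>finite ?T\<close> by (intro Min_le) auto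
        then have "i \<in> ?T"
          using i \<open>\<not> s' \<le> l\<close> by auto
        then have "s' \<le> f i"
          unfolding s'_def using \<open>finite ?T\<close> by (intro Min_le) auto
        then show False
          using i \<open>\<not> s' \<le> l\<close> by auto
      qed
      then have "?c l \<le> ?c s"
        by (intro card_mono fin)
      then show False
        using l not by simp
    qed
    then have "s' \<le> Inf ?L"
      using \<open>?L \<noteq> {}\<close> by (intro cInf_greatest) auto
    then show False
      using le s' by simp
  qed
qed

section \<open>Neumann modes as non-negative lattice points\<close>

definition mode_count :: "nat \<Rightarrow> (nat \<Rightarrow> real) \<Rightarrow> real \<Rightarrow> nat" where
  "mode_count n a s = card {i \<in> {1..n} \<rightarrow>\<^sub>E (UNIV :: nat set). neumann_mode n a i \<le> s}"

lemma bij_betw_PiE_of: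
  fixes f :: "'b \<Rightarrow> real"
  assumes "inj f"
  shows "bij_betw (\<lambda>i. \<lambda>j\<in>A. f (i j)) (A \<rightarrow>\<^sub>E UNIV) (A \<rightarrow>\<^sub>E range f)"
proof (rule bij_betwI')
  fix x y :: "'a \<Rightarrow> 'b" assume xy: "x \<in> A \<rightarrow>\<^sub>E UNIV" "y \<in> A \<rightarrow>\<^sub>E UNIV"
  show "((\<lambda>j\<in>A. f (x j)) = (\<lambda>j\<in>A. f (y j))) = (x = y)"
  proof
    assume eq: "(\<lambda>j\<in>A. f (x j)) = (\<lambda>j\<in>A. f (y j))"
    show "x = y"
    proof (rule PiE_ext[OF xy])
      fix j assume "j \<in> A"
      then have "f (x j) = f (y j)"
        using fun_cong[OF eq, of j] by simp
      then show "x j = y j"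
        using assms by (simp add: inj_eq)
    qed
  qed simp
next
  fix y assume y: "y \<in> A \<rightarrow>\<^sub>E range f"
  show "\<exists>x\<in>A \<rightarrow>\<^sub>E UNIV. y = (\<lambda>j\<in>A. f (x j))"
  proof (intro bexI ext)
    show "y j = (\<lambda>j\<in>A. f ((\<lambda>j\<in>A. inv f (y j)) j)) j" for j
      using y by (cases "j \<in> A") (auto simp: PiE_def Pi_def extensional_def f_inv_into_f)
  qed auto
qed auto

lemma neumann_mode_le_iff:
  "neumann_mode n a i \<le> s \<longleftrightarrow> (\<Sum>j=1..n. (real (i j))\<^sup>2 / (a j)\<^sup>2) \<le> s / pi\<^sup>2"
proof -
  have "neumann_mode n a i = pi\<^sup>2 * (\<Sum>j=1..n. (real (i j))\<^sup>2 / (a j)\<^sup>2)"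
    by (simp add: neumann_mode_def sum_distrib_left)
  then show ?thesis
    by (simp add: pos_le_divide_eq mult.commute)
qed

lemma bij_betw_modes:
  "bij_betw (\<lambda>i. \<lambda>j\<in>{1..n}. real (i j))
     {i \<in> {1..n} \<rightarrow>\<^sub>E (UNIV :: nat set). neumann_mode n a i \<le> s} (lattice_points \<nat> {1..n} a (s / pi\<^sup>2))"
  unfolding lattice_points_def Nats_def
  by (rule bij_betw_Collect[OF bij_betw_PiE_of]) (simp_all add: neumann_mode_le_iff)

lemma mode_count_eq: "mode_count n a s = lattice_count \<nat> {1..n} a (s / pi\<^sup>2)"
  unfolding mode_count_def lattice_count_def by (rule bij_betw_same_card[OF bij_betw_modes])

lemma ellipsoid_lattice_count_eq:
  "ellipsoid_lattice_count n a t = lattice_count \<int> {1..n} a (t\<^sup>2)"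
  unfolding ellipsoid_lattice_count_def lattice_count_def lattice_points_def Ints_def
  by (rule bij_betw_same_card[OF bij_betw_Collect[OF bij_betw_PiE_of]]) (simp_all add: inj_on_def)

lemma neumann_eigenvalue_le_iff:
  assumes n: "n \<ge> 1" and pos: "\<And>j. j \<in> {1..n} \<Longrightarrow> 0 < a j"
  shows "neumann_eigenvalue n a k \<le> s \<longleftrightarrow> k < mode_count n a s"
  unfolding neumann_eigenvalue_def mode_count_def
proof (rule Inf_counting_le_iff)
  show "finite {i \<in> {1..n} \<rightarrow>\<^sub>E UNIV. neumann_mode n a i \<le> l}" for l
    using bij_betw_finite[OF bij_betw_modes[of n a l]] finite_lattice_points[of "{1..n}" a \<nat>] pos
    by (simp add: Nats_subset_Ints)
  show "infinite ({1..n} \<rightarrow>\<^sub>E (UNIV :: nat set))"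
  proof
    assume fin: "finite ({1..n} \<rightarrow>\<^sub>E (UNIV :: nat set))"
    have "range (\<lambda>k::nat. \<lambda>j\<in>{1..n}. k) \<subseteq> {1..n} \<rightarrow>\<^sub>E UNIV"
      by auto
    then have "finite (range (\<lambda>k::nat. \<lambda>j\<in>{1..n}. k))"
      using fin by (rule finite_subset)
    moreover have "inj (\<lambda>k::nat. \<lambda>j\<in>{1..n}. k)"
    proof (rule injI)
      fix x y :: nat assume eq: "(\<lambda>j\<in>{1..n}. x) = (\<lambda>j\<in>{1..n}. y)"
      show "x = y"
        using fun_cong[OF eq, of 1] n by simp
    qed
    ultimately show False
      using finite_imageD infinite_UNIV_nat by blast
  qed
qed (auto simp: neumann_mode_def intro!: sum_nonneg)

lemma mode_count_mono:
  assumes "\<And>j. j \<in> {1..n} \<Longrightarrow> 0 < a j" "s \<le> s'"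
  shows "mode_count n a s \<le> mode_count n a s'"
  unfolding mode_count_eq
  using assms by (intro lattice_count_mono) (auto simp: Nats_subset_Ints divide_right_mono)

lemma neumann_riesz_mean_eq_sum:
  assumes n: "n \<ge> 1" and pos: "\<And>j. j \<in> {1..n} \<Longrightarrow> 0 < a j"
  shows "neumann_riesz_mean n \<gamma> \<mu> a = (\<Sum>k<mode_count n a \<mu>.
    if \<gamma> = 0 then 1 else (\<mu> - neumann_eigenvalue n a k) powr \<gamma>)"
proof -
  have "{k. neumann_eigenvalue n a k \<le> \<mu>} = {..<mode_count n a \<mu>}"
    using neumann_eigenvalue_le_iff[of n a] assms by auto
  then show ?thesis
    by (simp add: neumann_riesz_mean_def)
qed

text \<open>Layer-cake formula: by means of the substitution \<open>u = (\<mu> - s)\<^sup>\<gamma>\<close> the integrand is a step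
  function, without a singularity at \<open>s = \<mu>\<close> when \<open>\<gamma> < 1\<close>.\<close>

lemma has_integral_neumann_riesz_mean:
  assumes n: "n \<ge> 1" and pos: "\<And>j. j \<in> {1..n} \<Longrightarrow> 0 < a j" and \<gamma>: "\<gamma> > 0" and \<mu>: "\<mu> > 0"
  shows "((\<lambda>u. real (mode_count n a (\<mu> - u powr (1 / \<gamma>)))) has_integral neumann_riesz_mean n \<gamma> \<mu> a)
    {0..\<mu> powr \<gamma>}"
proof -
  let ?N = "mode_count n a \<mu>" and ?e = "neumann_eigenvalue n a"
  have iff: "?e k \<le> s \<longleftrightarrow> k < mode_count n a s" for k s
    using n pos by (rule neumann_eigenvalue_le_iff)
  have e_nonneg: "0 \<le> ?e k" for k
  proof (rule ccontr)
    assume "\<not> 0 \<le> ?e k"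
    then have "mode_count n a (?e k) = 0"
      unfolding mode_count_eq by (intro lattice_count_neg) (simp add: divide_neg_pos)
    then show False
      using iff[of k "?e k"] by simp
  qed
  \<comment> \<open>\<open>(\<mu> - ?e k) powr \<gamma>\<close> is the length of the interval of
    those \<open>u\<close> for which eigenvalue \<open>k\<close> is at most
    \<open>\<mu> - u powr (1 / \<gamma>)\<close>; adding the indicators of these intervals gives the
    counting function.\<close>
  let ?ind = "\<lambda>k u. if u \<in> {0..(\<mu> - ?e k) powr \<gamma>} then 1 else 0 :: real"
  have "((\<lambda>u. \<Sum>k<?N. ?ind k u) has_integral (\<Sum>k<?N. (\<mu> - ?e k) powr \<gamma>)) {0..\<mu> powr \<gamma>}"
  proof (rule has_integral_sum)
    fix k assume "k \<in> {..<?N}"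
    then have "?e k \<le> \<mu>"
      using iff by simp
    then have sub: "{0..(\<mu> - ?e k) powr \<gamma>} \<subseteq> {0..\<mu> powr \<gamma>}"
      using e_nonneg[of k] \<gamma> by (auto intro: order_trans powr_mono2)
    have "((\<lambda>_. 1::real) has_integral (\<mu> - ?e k) powr \<gamma>) {0..(\<mu> - ?e k) powr \<gamma>}"
      using has_integral_const_real[of "1::real" 0 "(\<mu> - ?e k) powr \<gamma>"] by simp
    then show "(?ind k has_integral (\<mu> - ?e k) powr \<gamma>) {0..\<mu> powr \<gamma>}"
      using sub by (simp only: has_integral_restrict)
  qed simp
  moreover have "(\<Sum>k<?N. ?ind k u) = real (mode_count n a (\<mu> - u powr (1 / \<gamma>)))"
    if u: "u \<in> {0..\<mu> powr \<gamma>}" for u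
  proof -
    let ?s = "\<mu> - u powr (1 / \<gamma>)"
    have "u \<in> {0..(\<mu> - ?e k) powr \<gamma>} \<longleftrightarrow> k < mode_count n a ?s" if "k < ?N" for k
    proof -
      have e: "0 \<le> \<mu> - ?e k"
        using that iff by simp
      have "u \<le> (\<mu> - ?e k) powr \<gamma> \<longleftrightarrow> u powr (1 / \<gamma>) \<le> \<mu> - ?e k"
      proof
        assume "u \<le> (\<mu> - ?e k) powr \<gamma>"
        then have "u powr (1 / \<gamma>) \<le> ((\<mu> - ?e k) powr \<gamma>) powr (1 / \<gamma>)"
          using u \<gamma> by (intro powr_mono2) auto
        then show "u powr (1 / \<gamma>) \<le> \<mu> - ?e k"
          using \<gamma> e by (simp add: powr_powr)
      next
        assume "u powr (1 / \<gamma>) \<le> \<mu> - ?e k"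
        then have "(u powr (1 / \<gamma>)) powr \<gamma> \<le> (\<mu> - ?e k) powr \<gamma>"
          using \<gamma> by (intro powr_mono2) auto
        then show "u \<le> (\<mu> - ?e k) powr \<gamma>"
          using \<gamma> u by (simp add: powr_powr)
      qed
      then show ?thesis
        using u iff[of k ?s] by auto
    qed
    then have "(\<Sum>k<?N. ?ind k u) = (\<Sum>k<?N. if k < mode_count n a ?s then 1 else 0)"
      by (intro sum.cong) auto
    also have "\<dots> = real (card {k \<in> {..<?N}. k < mode_count n a ?s})"
      by (simp add: sum.If_cases Int_def)
    also have "{k \<in> {..<?N}. k < mode_count n a ?s} = {..<mode_count n a ?s}"
      using mode_count_mono[of n a ?s \<mu>] pos by auto
    finally show ?thesis
      by simp
  qed
  ultimately have "((\<lambda>u. real (mode_count n a (\<mu> - u powr (1 / \<gamma>)))) has_integral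
      (\<Sum>k<?N. (\<mu> - ?e k) powr \<gamma>)) {0..\<mu> powr \<gamma>}"
    by (rule has_integral_eq[rotated])
  then show ?thesis
    using neumann_riesz_mean_eq_sum[of n a \<gamma> \<mu>] n pos \<gamma> by simp
qed

text \<open>The counting bound is integrated in the variable \<open>u\<close> of the layer-cake
  formula. For \<open>u \<le> (\<mu> / 2) powr \<gamma>\<close> the level \<open>s\<close> is at
  least \<open>\<mu> / 2\<close>; elsewhere the term with \<open>D\<close> is merely bounded below
  by 0. This loses a factor depending only on \<open>m\<close> and \<open>\<gamma>\<close>, and
  avoids evaluating a Beta integral.\<close>

lemma neumann_riesz_mean_compare:
  assumes n: "n \<ge> 1" and \<gamma>: "\<gamma> \<ge> 0" and \<mu>: "\<mu> > 0"
    and a: "\<And>j. j \<in> {1..n} \<Longrightarrow> 0 < a j" and b: "\<And>j. j \<in> {1..n} \<Longrightarrow> 0 < b j"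
    and D: "0 \<le> D"
    and le: "neumann_riesz_mean n \<gamma> \<mu> a \<le> neumann_riesz_mean n \<gamma> \<mu> b"
    and count: "\<And>s. 0 \<le> s \<Longrightarrow> s \<le> \<mu> \<Longrightarrow>
      D * sqrt s ^ m - E \<le> real (mode_count n a s) - real (mode_count n b s)"
  shows "D * sqrt (\<mu> / 2) ^ m * (\<mu> / 2) powr \<gamma> \<le> E * \<mu> powr \<gamma>"
proof (cases "\<gamma> = 0")
  case True
  have "D * sqrt (\<mu> / 2) ^ m \<le> D * sqrt \<mu> ^ m"
    using D \<mu> by (intro mult_left_mono power_mono) auto
  also have "\<dots> \<le> E"
    using count[of \<mu>] le \<mu> neumann_riesz_mean_eq_sum[of n a \<gamma> \<mu>] neumann_riesz_mean_eq_sum[of n b \<gamma> \<mu>]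
      n a b True by simp
  finally show ?thesis
    using True \<mu> by simp
next
  case False
  then have \<gamma>: "\<gamma> > 0"
    using assms by simp
  let ?G = "\<lambda>u. (if u \<in> {0..(\<mu> / 2) powr \<gamma>} then D * sqrt (\<mu> / 2) ^ m else 0) - E"
  have sub: "{0..(\<mu> / 2) powr \<gamma>} \<subseteq> {0..\<mu> powr \<gamma>}"
    using \<mu> \<gamma> by (auto intro: order_trans powr_mono2)
  have "((\<lambda>_. D * sqrt (\<mu> / 2) ^ m) has_integral D * sqrt (\<mu> / 2) ^ m * (\<mu> / 2) powr \<gamma>) {0..(\<mu> / 2) powr \<gamma>}"
    using has_integral_const_real[of "D * sqrt (\<mu> / 2) ^ m" 0 "(\<mu> / 2) powr \<gamma>"] by (simp add: mult.commute)
  then have "((\<lambda>u. if u \<in> {0..(\<mu> / 2) powr \<gamma>} then D * sqrt (\<mu> / 2) ^ m else 0) has_integral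
      D * sqrt (\<mu> / 2) ^ m * (\<mu> / 2) powr \<gamma>) {0..\<mu> powr \<gamma>}"
    using sub by (simp only: has_integral_restrict)
  moreover have "((\<lambda>_. E) has_integral E * \<mu> powr \<gamma>) {0..\<mu> powr \<gamma>}"
    using has_integral_const_real[of E 0 "\<mu> powr \<gamma>"] by (simp add: mult.commute)
  ultimately have "(?G has_integral D * sqrt (\<mu> / 2) ^ m * (\<mu> / 2) powr \<gamma> - E * \<mu> powr \<gamma>) {0..\<mu> powr \<gamma>}"
    by (rule has_integral_diff)
  moreover have "((\<lambda>u. real (mode_count n a (\<mu> - u powr (1 / \<gamma>))) - real (mode_count n b (\<mu> - u powr (1 / \<gamma>))))
      has_integral neumann_riesz_mean n \<gamma> \<mu> a - neumann_riesz_mean n \<gamma> \<mu> b) {0..\<mu> powr \<gamma>}"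
    using n a b \<gamma> \<mu> by (intro has_integral_diff has_integral_neumann_riesz_mean) auto
  ultimately have "D * sqrt (\<mu> / 2) ^ m * (\<mu> / 2) powr \<gamma> - E * \<mu> powr \<gamma>
      \<le> neumann_riesz_mean n \<gamma> \<mu> a - neumann_riesz_mean n \<gamma> \<mu> b"
  proof (rule has_integral_le)
    fix u assume u: "u \<in> {0..\<mu> powr \<gamma>}"
    let ?s = "\<mu> - u powr (1 / \<gamma>)"
    have root: "u powr (1 / \<gamma>) \<le> x" if "0 < x" "u \<le> x powr \<gamma>" for x
    proof -
      have "u powr (1 / \<gamma>) \<le> (x powr \<gamma>) powr (1 / \<gamma>)"
        using that u \<gamma> by (intro powr_mono2) auto
      then show ?thesis
        using \<gamma> that by (simp add: powr_powr)
    qed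
    have s: "0 \<le> ?s" "?s \<le> \<mu>"
      using root[of \<mu>] u \<mu> by auto
    have "?G u \<le> D * sqrt ?s ^ m - E"
    proof (cases "u \<in> {0..(\<mu> / 2) powr \<gamma>}")
      case True
      then have "\<mu> / 2 \<le> ?s"
        using root[of "\<mu> / 2"] \<mu> by auto
      then have "D * sqrt (\<mu> / 2) ^ m \<le> D * sqrt ?s ^ m"
        using D \<mu> by (intro mult_left_mono power_mono) auto
      then show ?thesis
        using True by simp
    next
      case False
      have "0 \<le> D * sqrt ?s ^ m"
        using D s by simp
      then show ?thesis
        using False by auto
    qed
    also have "\<dots> \<le> real (mode_count n a ?s) - real (mode_count n b ?s)"
      by (rule count[OF s])
    finally show "?G u \<le> real (mode_count n a ?s) - real (mode_count n b ?s)" .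
  qed
  then show ?thesis
    using le by simp
qed

subsection \<open>Thin cuboids\<close>

text \<open>Volume and elementary error of a section are both absorbed into one power. With
  \<open>k = n - 1\<close> this treats all proper sections of the cube as error; with
  \<open>k = n - 2\<close> only those of codimension at least 2.\<close>

lemma sum_lattice_count_le:
  assumes "finite A" "0 < u"
  shows "\<exists>C\<ge>0. \<forall>a\<in>A \<rightarrow> {0<..u}. \<forall>\<tau>\<ge>0.
    real (\<Sum>S | S \<subseteq> A \<and> card S \<le> k. lattice_count \<int> S a \<tau>) \<le> C * (1 + sqrt \<tau>) ^ k"
proof -
  have "\<exists>C\<ge>0. \<forall>a\<in>A \<rightarrow> {0<..u}. \<forall>\<tau>\<ge>0. real (lattice_count \<int> S a \<tau>) \<le> C * (1 + sqrt \<tau>) ^ k"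
    if S: "S \<subseteq> A" "card S \<le> k" for S
  proof -
    let ?m = "card S"
    have "finite S"
      using S assms(1) by (blast intro: finite_subset)
    from lattice_count_Ints_asymp[OF this assms(2)] obtain C where C: "C \<ge> 0"
      "\<And>a \<tau>. a \<in> S \<rightarrow> {0<..u} \<Longrightarrow> \<tau> \<ge> 0 \<Longrightarrow>
        \<bar>real (lattice_count \<int> S a \<tau>) - ellipsoid_vol S a * sqrt \<tau> ^ ?m\<bar>
          \<le> C * real ?m * (1 + sqrt \<tau>) ^ (?m - 1)"
      by blast
    let ?C' = "unit_ball_vol (real ?m) * u ^ ?m + C * real ?m"
    show ?thesis
    proof (intro exI[of _ ?C'] conjI ballI allI impI)
      show "0 \<le> ?C'"
        using C(1) assms(2) by simp
      fix a and \<tau> :: real assume a: "a \<in> A \<rightarrow> {0<..u}" and \<tau>: "0 \<le> \<tau>"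
      have aS: "a \<in> S \<rightarrow> {0<..u}"
        using a S(1) by auto
      have "(\<Prod>i\<in>S. a i) \<le> (\<Prod>i\<in>S. u)"
        using aS by (intro prod_mono) (auto simp: Pi_iff intro: less_imp_le)
      then have vol: "ellipsoid_vol S a \<le> unit_ball_vol (real ?m) * u ^ ?m"
        by (simp add: ellipsoid_vol_def mult_left_mono)
      have vol0: "0 \<le> ellipsoid_vol S a"
        using aS by (intro ellipsoid_vol_nonneg) (auto simp: Pi_iff)
      have "real (lattice_count \<int> S a \<tau>)
          \<le> ellipsoid_vol S a * sqrt \<tau> ^ ?m + C * real ?m * (1 + sqrt \<tau>) ^ (?m - 1)"
        using C(2)[OF aS \<tau>] by linarith
      also have "\<dots> \<le> unit_ball_vol (real ?m) * u ^ ?m * (1 + sqrt \<tau>) ^ ?m + C * real ?m * (1 + sqrt \<tau>) ^ ?m"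
        using vol vol0 C(1) \<tau> assms(2)
        by (intro add_mono mult_mono mult_left_mono power_mono power_increasing) auto
      also have "\<dots> = ?C' * (1 + sqrt \<tau>) ^ ?m"
        by (simp add: algebra_simps)
      also have "\<dots> \<le> ?C' * (1 + sqrt \<tau>) ^ k"
        using \<open>0 \<le> ?C'\<close> \<tau> S(2) by (intro mult_left_mono power_increasing) auto
      finally show "real (lattice_count \<int> S a \<tau>) \<le> ?C' * (1 + sqrt \<tau>) ^ k" .
    qed
  qed
  then obtain C where C: "\<And>S. S \<subseteq> A \<Longrightarrow> card S \<le> k \<Longrightarrow> C S \<ge> 0"
    "\<And>S a \<tau>. S \<subseteq> A \<Longrightarrow> card S \<le> k \<Longrightarrow> a \<in> A \<rightarrow> {0<..u} \<Longrightarrow> \<tau> \<ge> 0 \<Longrightarrow>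
      real (lattice_count \<int> S a \<tau>) \<le> C S * (1 + sqrt \<tau>) ^ k"
    by metis
  show ?thesis
  proof (intro exI[of _ "\<Sum>S | S \<subseteq> A \<and> card S \<le> k. C S"] conjI ballI allI impI)
    show "0 \<le> (\<Sum>S | S \<subseteq> A \<and> card S \<le> k. C S)"
      using C(1) by (intro sum_nonneg) auto
    fix a and \<tau> :: real assume "a \<in> A \<rightarrow> {0<..u}" "0 \<le> \<tau>"
    then show "real (\<Sum>S | S \<subseteq> A \<and> card S \<le> k. lattice_count \<int> S a \<tau>)
        \<le> (\<Sum>S | S \<subseteq> A \<and> card S \<le> k. C S) * (1 + sqrt \<tau>) ^ k"
      unfolding sum_distrib_right of_nat_sum using C(2) by (intro sum_mono) auto
  qed
qed

lemma unit_cube: "unit_cuboid n (\<lambda>_. 1)"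
  by (auto simp: unit_cuboid_def mono_on_def)

text \<open>An error of order \<open>t ^ (n - 1)\<close> suffices, because it competes with a gap of
  the same order whose coefficient contains \<open>1 / a 1\<close>.\<close>

lemma lattice_count_Nats_unit_cube_le:
  assumes n: "n \<ge> 1"
  shows "\<exists>C\<ge>0. \<forall>\<tau>\<ge>0. real (lattice_count \<nat> {1..n} (\<lambda>_. 1) \<tau>)
    \<le> orthant_vol n * sqrt \<tau> ^ n + C * (1 + sqrt \<tau>) ^ (n - 1)"
proof -
  let ?A = "{1..n}" and ?a = "\<lambda>_::nat. 1::real"
  obtain C1 where C1: "C1 \<ge> 0" "\<And>a \<tau>. a \<in> ?A \<rightarrow> {0<..1} \<Longrightarrow> \<tau> \<ge> 0 \<Longrightarrow>
      real (\<Sum>S | S \<subseteq> ?A \<and> card S \<le> n - 1. lattice_count \<int> S a \<tau>) \<le> C1 * (1 + sqrt \<tau>) ^ (n - 1)"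
    using sum_lattice_count_le[of ?A 1 "n - 1"] by auto
  obtain C2 where C2: "C2 \<ge> 0" "\<And>a \<tau>. a \<in> ?A \<rightarrow> {0<..1} \<Longrightarrow> \<tau> \<ge> 0 \<Longrightarrow>
      \<bar>real (lattice_count \<int> ?A a \<tau>) - ellipsoid_vol ?A a * sqrt \<tau> ^ n\<bar>
        \<le> C2 * real n * (1 + sqrt \<tau>) ^ (n - 1)"
    using lattice_count_Ints_asymp[of ?A 1] by auto
  have Pow: "Pow ?A = insert ?A {S. S \<subseteq> ?A \<and> card S \<le> n - 1}"
  proof -
    have "card S \<le> n - 1" if "S \<subseteq> ?A" "S \<noteq> ?A" for S
    proof -
      have "card S < card ?A"
        using that by (intro psubset_card_mono) auto
      then show ?thesis
        by simp
    qed
    then show ?thesis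
      by blast
  qed
  show ?thesis
  proof (intro exI[of _ "C2 * real n + C1"] conjI allI impI)
    show "0 \<le> C2 * real n + C1"
      using C1(1) C2(1) by simp
    fix \<tau> :: real assume \<tau>: "0 \<le> \<tau>"
    have "2 ^ n * lattice_count \<nat> ?A ?a \<tau> = (\<Sum>S\<in>Pow ?A. lattice_count \<int> S ?a \<tau>)"
      using lattice_count_Nats_eq_sum[of ?A ?a \<tau>] by simp
    also have "\<dots> = lattice_count \<int> ?A ?a \<tau> + (\<Sum>S | S \<subseteq> ?A \<and> card S \<le> n - 1. lattice_count \<int> S ?a \<tau>)"
      unfolding Pow using n by (subst sum.insert) auto
    finally have "real (2 ^ n * lattice_count \<nat> ?A ?a \<tau>) = real (lattice_count \<int> ?A ?a \<tau>
        + (\<Sum>S | S \<subseteq> ?A \<and> card S \<le> n - 1. lattice_count \<int> S ?a \<tau>))"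
      by (rule arg_cong)
    then have "2 ^ n * real (lattice_count \<nat> ?A ?a \<tau>) = real (lattice_count \<int> ?A ?a \<tau>)
        + real (\<Sum>S | S \<subseteq> ?A \<and> card S \<le> n - 1. lattice_count \<int> S ?a \<tau>)"
      by (simp only: of_nat_add of_nat_mult of_nat_power of_nat_numeral)
    also have "\<dots> \<le> ellipsoid_vol ?A ?a * sqrt \<tau> ^ n + C2 * real n * (1 + sqrt \<tau>) ^ (n - 1)
        + C1 * (1 + sqrt \<tau>) ^ (n - 1)"
      using C1(2)[of ?a \<tau>] C2(2)[of ?a \<tau>] \<tau> by force
    also have "\<dots> = 2 ^ n * (orthant_vol n * sqrt \<tau> ^ n) + (C2 * real n + C1) * (1 + sqrt \<tau>) ^ (n - 1)"
      by (simp add: ellipsoid_vol_def orthant_vol_def algebra_simps)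
    also have "\<dots> \<le> 2 ^ n * (orthant_vol n * sqrt \<tau> ^ n + (C2 * real n + C1) * (1 + sqrt \<tau>) ^ (n - 1))"
    proof -
      have "1 * ((C2 * real n + C1) * (1 + sqrt \<tau>) ^ (n - 1))
          \<le> 2 ^ n * ((C2 * real n + C1) * (1 + sqrt \<tau>) ^ (n - 1))"
        using C1(1) C2(1) \<tau> by (intro mult_right_mono) auto
      then show ?thesis
        by (simp add: distrib_left)
    qed
    finally show "real (lattice_count \<nat> ?A ?a \<tau>)
        \<le> orthant_vol n * sqrt \<tau> ^ n + (C2 * real n + C1) * (1 + sqrt \<tau>) ^ (n - 1)"
      by simp
  qed
qed

lemma sqrt_scale_le:
  assumes "\<mu> \<ge> 1"
  shows "1 + sqrt (\<mu> / pi\<^sup>2) \<le> 2 * sqrt \<mu>"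
proof -
  have "sqrt (\<mu> / pi\<^sup>2) = sqrt \<mu> / pi"
    by (simp add: real_sqrt_divide)
  also have "\<dots> \<le> sqrt \<mu> / 1"
    using pi_gt3 assms by (intro divide_left_mono) auto
  finally have "sqrt (\<mu> / pi\<^sup>2) \<le> sqrt \<mu>"
    by simp
  then show ?thesis
    using real_sqrt_ge_one[OF assms] by linarith
qed

lemma clear_denominators:
  fixes x r M y :: real
  assumes "x / p * (r / q) * (M / g) \<le> y * M" "0 < p" "0 < q" "0 < g" "0 < M"
  shows "x * r \<le> y * p * q * g"
proof -
  have "x / p * (r / q) * (M / g) = (x * r) / (p * q * g) * M"
    by (simp add: mult_ac)
  with assms have "(x * r) / (p * q * g) \<le> y"
    by (metis mult_le_cancel_right_pos)
  with assms show ?thesis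
    by (simp add: pos_divide_le_eq mult.assoc)
qed

text \<open>A lower bound on the shortest side is enough for compactness: the other
  \<open>n - 1\<close> factors of the product 1 cannot compensate for a large last side.\<close>

lemma unit_cuboid_bounded:
  assumes a: "unit_cuboid n a" and n: "n \<ge> 1" and B: "0 < B" "1 / B \<le> a 1"
  shows "j \<in> {1..n} \<Longrightarrow> 1 / B \<le> a j" "a n \<le> B ^ (n - 1)" "1 \<le> a n" "j \<in> {1..n} \<Longrightarrow> a j \<le> a n"
proof -
  have pos: "\<And>j. j \<in> {1..n} \<Longrightarrow> 0 < a j" and prod: "(\<Prod>i=1..n. a i) = 1"
    and mono: "\<And>i j. 1 \<le> i \<Longrightarrow> i \<le> j \<Longrightarrow> j \<le> n \<Longrightarrow> a i \<le> a j"
    using a by (auto simp: unit_cuboid_def mono_on_def)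
  show lower: "1 / B \<le> a j" if "j \<in> {1..n}" for j
    using B mono[of 1 j] that by auto
  show upper: "a j \<le> a n" if "j \<in> {1..n}" for j
    using mono[of j n] that by auto
  have "(1 / B) ^ (n - 1) * a n \<le> (\<Prod>i=1..<n. a i) * a n"
  proof (rule mult_right_mono)
    have "(\<Prod>i=1..<n. 1 / B) \<le> (\<Prod>i=1..<n. a i)"
      using B lower by (intro prod_mono) auto
    then show "(1 / B) ^ (n - 1) \<le> (\<Prod>i=1..<n. a i)"
      by simp
  qed (use pos[of n] n in auto)
  also have "\<dots> = (\<Prod>i=1..n. a i)"
    using n by (simp add: prod.last_plus mult.commute)
  finally show "a n \<le> B ^ (n - 1)"
    using B prod by (simp add: power_divide field_simps)
  have "1 \<le> a n ^ n"
  proof -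
    have "(\<Prod>i=1..n. a i) \<le> (\<Prod>i=1..n. a n)"
      using pos upper by (intro prod_mono) (auto intro: less_imp_le)
    then show ?thesis
      using prod by simp
  qed
  then show "1 \<le> a n"
    using pos[of n] n power_less_one_iff[of "a n" n] by (auto simp: not_le [symmetric])
qed

lemma minimising_cuboid_thickness:
  assumes n: "n \<ge> 2" and \<gamma>: "\<gamma> \<ge> 0"
  shows "\<exists>B>0. \<forall>\<mu>\<ge>1. \<forall>a. minimising_cuboid n \<gamma> \<mu> a \<longrightarrow> 1 / B \<le> a 1"
proof -
  let ?m = "n - 1" and ?A = "{2..n}"
  obtain C where C: "C \<ge> 0" "\<And>\<tau>. \<tau> \<ge> 0 \<Longrightarrow> real (lattice_count \<nat> {1..n} (\<lambda>_. 1) \<tau>)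
      \<le> orthant_vol n * sqrt \<tau> ^ n + C * (1 + sqrt \<tau>) ^ ?m"
    using lattice_count_Nats_unit_cube_le[of n] n by auto
  define c where "c = orthant_vol ?m / (512 * 2 ^ ?m)"
  have c: "0 < c"
    by (simp add: c_def orthant_vol_pos)
  \<comment> \<open>The factors undo the losses: \<open>2\<close> comes from
    \<open>sqrt_scale_le\<close>, \<open>pi\<close> from the scaling \<open>s / pi\<^sup>2\<close>,
    \<open>sqrt 2\<close> and \<open>2 powr \<gamma>\<close> from the level
    \<open>\<mu> / 2\<close>. Using \<open>C + 1\<close> makes \<open>B\<close> positive even if
    \<open>C = 0\<close>.\<close>
  define B where "B = (C + 1) * (2 * pi * sqrt 2) ^ ?m * 2 powr \<gamma> / c"
  have B: "0 < B"
    using C(1) c by (simp add: B_def)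
  show ?thesis
  proof (intro exI[of _ B] conjI allI impI)
    fix \<mu> :: real and a assume \<mu>: "1 \<le> \<mu>" and min: "minimising_cuboid n \<gamma> \<mu> a"
    have unit: "unit_cuboid n a"
      using min by (simp add: minimising_cuboid_def is_arg_min_def)
    have le: "neumann_riesz_mean n \<gamma> \<mu> a \<le> neumann_riesz_mean n \<gamma> \<mu> (\<lambda>_. 1)"
      using min unit_cube[of n] by (auto simp: minimising_cuboid_def is_arg_min_def not_less)
    have pos: "\<And>j. j \<in> {1..n} \<Longrightarrow> 0 < a j" and prod: "(\<Prod>i=1..n. a i) = 1"
      using unit by (auto simp: unit_cuboid_def)
    \<comment> \<open>The slices are taken along the shortest side, so that the remaining sides have
      product \<open>1 / a 1\<close>.\<close>
    have ins: "{1..n} = insert 1 ?A"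
      using n by auto
    have a1: "0 < a 1"
      using pos n by simp
    have "a 1 * (\<Prod>i\<in>?A. a i) = 1"
      using prod unfolding ins by simp
    then have prodA: "(\<Prod>i\<in>?A. a i) = 1 / a 1"
      using a1 by (simp add: field_simps)
    let ?D = "c / a 1 / pi ^ ?m"
    have "?D * sqrt (\<mu> / 2) ^ ?m * (\<mu> / 2) powr \<gamma> \<le> C * (1 + sqrt (\<mu> / pi\<^sup>2)) ^ ?m * \<mu> powr \<gamma>"
    proof (rule neumann_riesz_mean_compare[OF _ \<gamma> _ pos _ _ le])
      fix s :: real assume s: "0 \<le> s" "s \<le> \<mu>"
      let ?\<tau> = "s / pi\<^sup>2"
      have \<tau>: "0 \<le> ?\<tau>"
        using s by simp
      have root: "sqrt ?\<tau> = sqrt s / pi"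
        by (simp add: real_sqrt_divide)
      have cardA: "card ?A = ?m" "?m + 1 = n"
        using n by auto
      have "orthant_vol (card ?A + 1) * (\<Prod>i\<in>insert 1 ?A. a i) * sqrt ?\<tau> ^ (card ?A + 1)
          + orthant_vol (card ?A) / (512 * 2 ^ card ?A) * (\<Prod>i\<in>?A. a i) * sqrt ?\<tau> ^ card ?A
          \<le> lattice_count \<nat> (insert 1 ?A) a ?\<tau>"
        using n pos \<tau> by (intro lattice_count_Nats_lower_gap) auto
      then have "orthant_vol n * sqrt ?\<tau> ^ n + c / a 1 * sqrt ?\<tau> ^ ?m \<le> lattice_count \<nat> {1..n} a ?\<tau>"
        unfolding ins [symmetric] cardA prod prodA by (simp add: c_def)
      moreover have "real (lattice_count \<nat> {1..n} (\<lambda>_. 1) ?\<tau>)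
          \<le> orthant_vol n * sqrt ?\<tau> ^ n + C * (1 + sqrt (\<mu> / pi\<^sup>2)) ^ ?m"
      proof -
        have "C * (1 + sqrt ?\<tau>) ^ ?m \<le> C * (1 + sqrt (\<mu> / pi\<^sup>2)) ^ ?m"
          using C(1) s by (intro mult_left_mono power_mono add_left_mono real_sqrt_le_mono divide_right_mono) auto
        with C(2)[OF \<tau>] show ?thesis
          by linarith
      qed
      moreover have "?D * sqrt s ^ ?m = c / a 1 * sqrt ?\<tau> ^ ?m"
        unfolding root by (simp add: power_divide)
      ultimately show "?D * sqrt s ^ ?m - C * (1 + sqrt (\<mu> / pi\<^sup>2)) ^ ?m
          \<le> real (mode_count n a s) - real (mode_count n (\<lambda>_. 1) s)"
        unfolding mode_count_eq by linarith
    qed (use n \<mu> c a1 in auto)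
    also have "\<dots> \<le> (C + 1) * (2 * sqrt \<mu>) ^ ?m * \<mu> powr \<gamma>"
      using C(1) \<mu> sqrt_scale_le[OF \<mu>] by (intro mult_right_mono mult_mono power_mono) auto
    finally have "c / a 1 / pi ^ ?m * (sqrt \<mu> ^ ?m / sqrt 2 ^ ?m) * (\<mu> powr \<gamma> / 2 powr \<gamma>)
        \<le> (C + 1) * (2 ^ ?m * sqrt \<mu> ^ ?m) * \<mu> powr \<gamma>"
      using \<mu> by (simp add: real_sqrt_divide power_divide powr_divide power_mult_distrib)
    then have "c / a 1 * sqrt \<mu> ^ ?m
        \<le> (C + 1) * (2 ^ ?m * sqrt \<mu> ^ ?m) * pi ^ ?m * sqrt 2 ^ ?m * 2 powr \<gamma>"
      using \<mu> by (intro clear_denominators) auto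
    also have "\<dots> = B * c * sqrt \<mu> ^ ?m"
      using c by (simp add: B_def power_mult_distrib)
    finally have "c / a 1 \<le> B * c"
      by (rule mult_right_le_imp_le) (use \<mu> in simp)
    then show "1 / B \<le> a 1"
      using a1 c B by (simp add: field_simps)
  qed (rule B)
qed

subsection \<open>Two-term asymptotics\<close>

text \<open>For the unit cube the number of lattice points is constant for \<open>\<surd>k \<le> t < \<surd>(k + 1)\<close>,
  while the volume grows by an amount of order \<open>t ^ (n - 2)\<close>.\<close>

lemma admissible_exponent_ge:
  assumes n: "n \<ge> 2" and adm: "admissible_exponent n \<theta>"
  shows "real n - 2 \<le> \<theta>"
proof (rule ccontr)
  assume "\<not> real n - 2 \<le> \<theta>"
  define e where "e = n - 2"
  have e: "\<theta> - real e < 0" "n = e + 2"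
    using \<open>\<not> _\<close> n by (auto simp: e_def)
  let ?\<omega> = "unit_ball_vol (real n)" and ?Z = "ellipsoid_lattice_count n (\<lambda>_. 1)"
  obtain C where C: "\<forall>\<^sub>F t in at_top. \<forall>a \<in> {1..n} \<rightarrow> {1}.
      \<bar>real (ellipsoid_lattice_count n a t) - ?\<omega> * t ^ n * (\<Prod>i=1..n. a i)\<bar> \<le> C * t powr \<theta>"
    using adm[unfolded admissible_exponent_def, rule_format, of "{1}"] by auto
  have "\<forall>\<^sub>F t in at_top. \<bar>real (?Z t) - ?\<omega> * t ^ n\<bar> \<le> \<bar>C\<bar> * t powr \<theta>"
    using C
  proof eventually_elim
    case (elim t)
    then have "\<bar>real (?Z t) - ?\<omega> * t ^ n\<bar> \<le> C * t powr \<theta>"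
      by (auto dest: bspec[of _ _ "\<lambda>_. 1"])
    also have "\<dots> \<le> \<bar>C\<bar> * t powr \<theta>"
      by (intro mult_right_mono) auto
    finally show ?case .
  qed
  then obtain t0 where t0: "\<And>t. t \<ge> t0 \<Longrightarrow> \<bar>real (?Z t) - ?\<omega> * t ^ n\<bar> \<le> \<bar>C\<bar> * t powr \<theta>"
    by (auto simp: eventually_at_top_linorder)
  have root: "filterlim (\<lambda>k. sqrt (real k)) at_top sequentially"
    by (rule filterlim_compose[OF sqrt_at_top filterlim_real_sequentially])
  \<comment> \<open>The errors at \<open>y\<close> and at \<open>x \<le> 2 * y\<close> add up to at
    most \<open>\<bar>C\<bar> * (1 + 2 ^ e) * y powr (\<theta> - e) * y ^ e\<close>, to be compared
    with a volume growth of at least \<open>?\<omega> / 2 * y ^ e\<close>.\<close>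
  have "((\<lambda>y. \<bar>C\<bar> * (1 + 2 ^ e) * y powr (\<theta> - real e)) \<longlongrightarrow> \<bar>C\<bar> * (1 + 2 ^ e) * 0) at_top"
    using e by (intro tendsto_mult tendsto_const tendsto_neg_powr filterlim_ident) auto
  then have "\<forall>\<^sub>F y in at_top. \<bar>C\<bar> * (1 + 2 ^ e) * y powr (\<theta> - real e) < ?\<omega> / 2"
    by (rule order_tendstoD) simp
  then have "\<forall>\<^sub>F k in sequentially. \<bar>C\<bar> * (1 + 2 ^ e) * sqrt (real k) powr (\<theta> - real e) < ?\<omega> / 2"
    using root by (rule eventually_compose_filterlim)
  moreover have "\<forall>\<^sub>F k in sequentially. max 1 t0 \<le> sqrt (real k)"
    using root unfolding filterlim_at_top by blast
  ultimately have "\<forall>\<^sub>F k in sequentially. False"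
  proof eventually_elim
    case (elim k)
    \<comment> \<open>Squared radii \<open>k\<close> and \<open>k + 1 / 2\<close> enclose the same
      points, since the sums of squares are integers.\<close>
    define x y where "x = sqrt (real k + 1 / 2)" and "y = sqrt (real k)"
    have y: "1 \<le> y" "t0 \<le> y" "y \<le> x" and sq: "x\<^sup>2 = y\<^sup>2 + 1 / 2"
      using elim(2) by (auto simp: x_def y_def)
    have "1 \<le> y\<^sup>2"
      using y(1) by (rule one_le_power)
    then have "x\<^sup>2 \<le> (2 * y)\<^sup>2"
      unfolding sq power_mult_distrib by simp
    then have x: "x \<le> 2 * y"
      by (rule power2_le_imp_le) (use y in simp)
    have "?Z x = ?Z y"
    proof -
      have "(\<Sum>i=1..n. (real_of_int (z i))\<^sup>2 / 1\<^sup>2) \<le> x\<^sup>2 \<longleftrightarrow> (\<Sum>i=1..n. (real_of_int (z i))\<^sup>2 / 1\<^sup>2) \<le> y\<^sup>2"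
        for z
      proof -
        have int: "(\<Sum>i=1..n. (real_of_int (z i))\<^sup>2 / 1\<^sup>2) = real_of_int (\<Sum>i=1..n. (z i)\<^sup>2)"
          by simp
        have sq': "x\<^sup>2 = real k + 1 / 2" "y\<^sup>2 = real k"
          by (auto simp: x_def y_def)
        have "real_of_int q \<le> real k + 1 / 2 \<longleftrightarrow> real_of_int q \<le> real k" for q
        proof
          assume "real_of_int q \<le> real k + 1 / 2"
          then have "q \<le> int k"
            by linarith
          then show "real_of_int q \<le> real k"
            by linarith
        qed simp
        then show ?thesis
          unfolding int sq' .
      qed
      then show ?thesis
        unfolding ellipsoid_lattice_count_def by simp
    qed
    then have "?\<omega> * x ^ n - ?\<omega> * y ^ n \<le> \<bar>C\<bar> * y powr \<theta> + \<bar>C\<bar> * x powr \<theta>"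
      using t0[of x] t0[of y] y by linarith
    moreover have "y ^ e / 2 \<le> x ^ n - y ^ n"
    proof -
      have "y ^ e * (x\<^sup>2 - y\<^sup>2) \<le> x ^ e * x\<^sup>2 - y ^ e * y\<^sup>2"
        using y by (auto simp: algebra_simps intro!: mult_left_mono power_mono)
      moreover have "x\<^sup>2 - y\<^sup>2 = 1 / 2"
        using sq by simp
      ultimately show ?thesis
        unfolding e(2) power_add by simp
    qed
    then have "?\<omega> * (y ^ e / 2) \<le> ?\<omega> * (x ^ n - y ^ n)"
      by (intro mult_left_mono) auto
    \<comment> \<open>The sign of \<theta> is not known, so the power is split into one factor with
      negative exponent, bounded at \<open>y\<close>, and one with exponent \<open>e\<close>,
      bounded at \<open>2 * y\<close>.\<close>
    moreover have "x powr \<theta> \<le> 2 ^ e * (y powr (\<theta> - real e) * y ^ e)"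
    proof -
      have "x powr \<theta> = x powr (\<theta> - real e) * x ^ e"
        using y by (simp add: powr_diff powr_realpow)
      also have "\<dots> \<le> y powr (\<theta> - real e) * (2 * y) ^ e"
        using x y e by (intro mult_mono power_mono powr_mono2') auto
      finally show ?thesis
        by (simp add: power_mult_distrib mult_ac)
    qed
    then have "\<bar>C\<bar> * x powr \<theta> \<le> \<bar>C\<bar> * (2 ^ e * (y powr (\<theta> - real e) * y ^ e))"
      by (intro mult_left_mono) auto
    moreover have "y powr \<theta> = y powr (\<theta> - real e) * y ^ e"
      using y by (simp add: powr_diff powr_realpow)
    ultimately have "?\<omega> / 2 * y ^ e \<le> \<bar>C\<bar> * (1 + 2 ^ e) * y powr (\<theta> - real e) * y ^ e"
      by (simp add: algebra_simps)
    then have "?\<omega> / 2 \<le> \<bar>C\<bar> * (1 + 2 ^ e) * y powr (\<theta> - real e)"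
      using y by simp
    then show ?case
      using elim(1) by (simp add: y_def)
  qed
  then show False
    by simp
qed

text \<open>Admissibility speaks only of large radii; the bounded range below \<open>t0\<close> is
  covered by the elementary error. Writing \<open>1 + sqrt \<tau>\<close> keeps the bound away from
  0 there, using \<open>0 \<le> \<theta>\<close>.\<close>

lemma admissible_exponent_error:
  assumes "0 \<le> \<theta>" "0 < l" and adm: "admissible_exponent n \<theta>"
  shows "\<exists>C\<ge>0. \<forall>a\<in>{1..n} \<rightarrow> {l..u}. \<forall>\<tau>\<ge>0.
    \<bar>real (lattice_count \<int> {1..n} a \<tau>) - ellipsoid_vol {1..n} a * sqrt \<tau> ^ n\<bar>
      \<le> C * (1 + sqrt \<tau>) powr \<theta>"
proof -
  have "compact {l..u} \<and> {l..u} \<subseteq> {0<..}"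
    using assms(2) by auto
  then obtain C where "\<forall>\<^sub>F t in at_top. \<forall>a \<in> {1..n} \<rightarrow> {l..u}.
      \<bar>real (ellipsoid_lattice_count n a t) - unit_ball_vol (real n) * t ^ n * (\<Prod>i=1..n. a i)\<bar> \<le> C * t powr \<theta>"
    using adm unfolding admissible_exponent_def by blast
  then obtain t0 where t0: "\<And>t a. t \<ge> t0 \<Longrightarrow> a \<in> {1..n} \<rightarrow> {l..u} \<Longrightarrow>
      \<bar>real (ellipsoid_lattice_count n a t) - unit_ball_vol (real n) * t ^ n * (\<Prod>i=1..n. a i)\<bar> \<le> C * t powr \<theta>"
    by (auto simp: eventually_at_top_linorder)
  obtain C2 where C2: "C2 \<ge> 0" "\<And>a \<tau>. a \<in> {1..n} \<rightarrow> {0<..max 1 u} \<Longrightarrow> \<tau> \<ge> 0 \<Longrightarrow>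
      \<bar>real (lattice_count \<int> {1..n} a \<tau>) - ellipsoid_vol {1..n} a * sqrt \<tau> ^ n\<bar>
        \<le> C2 * real n * (1 + sqrt \<tau>) ^ (n - 1)"
    using lattice_count_Ints_asymp[of "{1..n}" "max 1 u"] by (auto simp: less_max_iff_disj)
  let ?C = "\<bar>C\<bar> + C2 * real n * (1 + \<bar>t0\<bar>) ^ (n - 1)"
  show ?thesis
  proof (intro exI[of _ ?C] conjI ballI allI impI)
    show "0 \<le> ?C"
      using C2(1) by simp
    fix a and \<tau> :: real assume a: "a \<in> {1..n} \<rightarrow> {l..u}" and \<tau>: "0 \<le> \<tau>"
    let ?err = "\<bar>real (lattice_count \<int> {1..n} a \<tau>) - ellipsoid_vol {1..n} a * sqrt \<tau> ^ n\<bar>"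
    have "1 \<le> (1 + sqrt \<tau>) powr \<theta>"
      using assms(1) \<tau> by (intro ge_one_powr_ge_zero) auto
    show "?err \<le> ?C * (1 + sqrt \<tau>) powr \<theta>"
    proof (cases "t0 \<le> sqrt \<tau>")
      case True
      from t0[OF this a] \<tau> have "?err \<le> C * sqrt \<tau> powr \<theta>"
        by (simp add: ellipsoid_lattice_count_eq ellipsoid_vol_def mult_ac)
      also have "\<dots> \<le> \<bar>C\<bar> * (1 + sqrt \<tau>) powr \<theta>"
        using assms(1) \<tau> by (intro mult_mono powr_mono2) auto
      also have "\<dots> \<le> ?C * (1 + sqrt \<tau>) powr \<theta>"
        using C2(1) by (intro mult_right_mono) auto
      finally show ?thesis .
    next
      case False
      have "?err \<le> C2 * real n * (1 + sqrt \<tau>) ^ (n - 1)"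
        using a \<tau> assms(2) by (intro C2(2)) (auto simp: Pi_iff dest: less_le_trans)
      also have "\<dots> \<le> C2 * real n * (1 + \<bar>t0\<bar>) ^ (n - 1)"
        using False C2(1) \<tau> by (intro mult_left_mono power_mono) auto
      also have "\<dots> \<le> ?C * 1"
        by simp
      also have "\<dots> \<le> ?C * (1 + sqrt \<tau>) powr \<theta>"
        using \<open>0 \<le> ?C\<close> \<open>1 \<le> _\<close> by (intro mult_left_mono)
      finally show ?thesis .
    qed
  qed
qed

text \<open>The subsets are sorted by whether the complement has 0, 1 or more elements. For
  \<open>card A = 1\<close> truncated subtraction would count the empty set twice, hence
  \<open>card A \<ge> 2\<close>.\<close>

lemma sum_Pow_codim:
  fixes F :: "'a set \<Rightarrow> nat"
  assumes A: "finite A" "card A \<ge> 2"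
  shows "(\<Sum>S\<in>Pow A. F S)
    = F A + (\<Sum>j\<in>A. F (A - {j})) + (\<Sum>S | S \<subseteq> A \<and> card S \<le> card A - 2. F S)"
proof -
  let ?L = "{S. S \<subseteq> A \<and> card S \<le> card A - 2}" and ?M = "(\<lambda>j. A - {j}) ` A"
  have fin: "finite ?L"
    using A(1) by simp
  have card: "card (A - {j}) = card A - 1" if "j \<in> A" for j
    using that A(1) by simp
  have "S \<in> ?M \<union> ?L" if S: "S \<subseteq> A" "S \<noteq> A" for S
  proof (cases "card S \<le> card A - 2")
    case False
    have "card (A - S) = card A - card S"
      using S A(1) by (intro card_Diff_subset) (auto intro: finite_subset)
    moreover have "card S < card A"
      using S A(1) by (intro psubset_card_mono) auto
    ultimately have "card (A - S) = 1"
      using False A(2) by linarith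
    then obtain j where "A - S = {j}"
      by (auto simp: card_1_singleton_iff)
    then have "S = A - {j}" "j \<in> A"
      using S by auto
    then show ?thesis
      by blast
  qed (use S in auto)
  then have "Pow A = insert A (?M \<union> ?L)"
    by auto
  moreover have "A \<notin> ?M \<union> ?L"
    using A by auto
  moreover have "?M \<inter> ?L = {}"
    using A card by fastforce
  ultimately have "(\<Sum>S\<in>Pow A. F S) = F A + ((\<Sum>S\<in>?M. F S) + (\<Sum>S\<in>?L. F S))"
    using A(1) fin by (simp add: sum.union_disjoint)
  moreover have "(\<Sum>S\<in>?M. F S) = (\<Sum>j\<in>A. F (A - {j}))"
    by (subst sum.reindex) (auto simp: inj_on_def)
  ultimately show ?thesis
    by simp
qed

text \<open>The product condition turns the product of all sides but the one with index
  \<open>j\<close> into \<open>1 / a j\<close>; this is where the boundary term gets its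
  shape.\<close>

lemma lattice_count_codim_1:
  assumes n: "n \<ge> 1" and u: "0 < u"
  shows "\<exists>C\<ge>0. \<forall>a\<in>{1..n} \<rightarrow> {0<..u}. \<forall>\<tau>\<ge>0. (\<Prod>i=1..n. a i) = 1 \<longrightarrow>
    \<bar>(\<Sum>j=1..n. real (lattice_count \<int> ({1..n} - {j}) a \<tau>))
       - unit_ball_vol (real (n - 1)) * (\<Sum>j=1..n. 1 / a j) * sqrt \<tau> ^ (n - 1)\<bar>
      \<le> C * (1 + sqrt \<tau>) ^ (n - 2)"
proof -
  have "\<exists>C\<ge>0. \<forall>a\<in>{1..n} - {j} \<rightarrow> {0<..u}. \<forall>\<tau>\<ge>0.
      \<bar>real (lattice_count \<int> ({1..n} - {j}) a \<tau>) - ellipsoid_vol ({1..n} - {j}) a * sqrt \<tau> ^ (n - 1)\<bar>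
        \<le> C * real (n - 1) * (1 + sqrt \<tau>) ^ (n - 2)" if j: "j \<in> {1..n}" for j
  proof -
    have "card ({1..n} - {j}) = n - 1"
      using j by simp
    moreover have "n - 1 - 1 = n - 2"
      by simp
    ultimately show ?thesis
      using lattice_count_Ints_asymp[of "{1..n} - {j}" u] u by (metis finite_Diff finite_atLeastAtMost)
  qed
  then obtain C where C: "\<And>j. j \<in> {1..n} \<Longrightarrow> 0 \<le> C j"
    "\<And>j a \<tau>. j \<in> {1..n} \<Longrightarrow> a \<in> {1..n} - {j} \<rightarrow> {0<..u} \<Longrightarrow> \<tau> \<ge> 0 \<Longrightarrow>
      \<bar>real (lattice_count \<int> ({1..n} - {j}) a \<tau>) - ellipsoid_vol ({1..n} - {j}) a * sqrt \<tau> ^ (n - 1)\<bar>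
        \<le> C j * real (n - 1) * (1 + sqrt \<tau>) ^ (n - 2)"
    by metis
  show ?thesis
  proof (intro exI[of _ "\<Sum>j=1..n. C j * real (n - 1)"] conjI ballI allI impI)
    show "0 \<le> (\<Sum>j=1..n. C j * real (n - 1))"
      using C(1) by (intro sum_nonneg) auto
    fix a and \<tau> :: real assume a: "a \<in> {1..n} \<rightarrow> {0<..u}" and \<tau>: "0 \<le> \<tau>" and prod: "(\<Prod>i=1..n. a i) = 1"
    have vol: "ellipsoid_vol ({1..n} - {j}) a = unit_ball_vol (real (n - 1)) * (1 / a j)" if j: "j \<in> {1..n}" for j
    proof -
      have "a j * (\<Prod>i\<in>{1..n} - {j}. a i) = 1"
        using prod prod.remove[of "{1..n}" j a] j by simp
      moreover have "0 < a j"
        using a j by (auto simp: Pi_iff)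
      ultimately have "(\<Prod>i\<in>{1..n} - {j}. a i) = 1 / a j"
        by (simp add: field_simps)
      then show ?thesis
        using j by (simp add: ellipsoid_vol_def)
    qed
    have "\<bar>(\<Sum>j=1..n. real (lattice_count \<int> ({1..n} - {j}) a \<tau>))
        - unit_ball_vol (real (n - 1)) * (\<Sum>j=1..n. 1 / a j) * sqrt \<tau> ^ (n - 1)\<bar>
      = \<bar>\<Sum>j=1..n. real (lattice_count \<int> ({1..n} - {j}) a \<tau>)
          - ellipsoid_vol ({1..n} - {j}) a * sqrt \<tau> ^ (n - 1)\<bar>"
      by (simp add: vol sum_subtractf sum_distrib_left sum_distrib_right del: of_nat_diff One_nat_def)
    also have "\<dots> \<le> (\<Sum>j=1..n. C j * real (n - 1) * (1 + sqrt \<tau>) ^ (n - 2))"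
      using a \<tau> by (intro order_trans[OF sum_abs] sum_mono C(2)) auto
    finally show "\<bar>(\<Sum>j=1..n. real (lattice_count \<int> ({1..n} - {j}) a \<tau>))
        - unit_ball_vol (real (n - 1)) * (\<Sum>j=1..n. 1 / a j) * sqrt \<tau> ^ (n - 1)\<bar>
      \<le> (\<Sum>j=1..n. C j * real (n - 1)) * (1 + sqrt \<tau>) ^ (n - 2)"
      by (simp add: sum_distrib_right)
  qed
qed

lemma lattice_count_Nats_compare_cube:
  assumes n: "n \<ge> 2" and adm: "admissible_exponent n \<theta>" and l: "0 < l" "l \<le> 1" "1 \<le> u"
  shows "\<exists>C\<ge>0. \<forall>a\<in>{1..n} \<rightarrow> {l..u}. \<forall>\<tau>\<ge>0. (\<Prod>i=1..n. a i) = 1 \<longrightarrow>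
    unit_ball_vol (real (n - 1)) / 2 ^ n * ((\<Sum>j=1..n. 1 / a j) - real n) * sqrt \<tau> ^ (n - 1)
      - C * (1 + sqrt \<tau>) powr \<theta>
    \<le> real (lattice_count \<nat> {1..n} a \<tau>) - real (lattice_count \<nat> {1..n} (\<lambda>_. 1) \<tau>)"
proof -
  have \<theta>: "real n - 2 \<le> \<theta>"
    using n adm by (rule admissible_exponent_ge)
  then have "0 \<le> \<theta>"
    using n by simp
  obtain C1 where C1: "C1 \<ge> 0" "\<And>a \<tau>. a \<in> {1..n} \<rightarrow> {l..u} \<Longrightarrow> \<tau> \<ge> 0 \<Longrightarrow>
    \<bar>real (lattice_count \<int> {1..n} a \<tau>) - ellipsoid_vol {1..n} a * sqrt \<tau> ^ n\<bar> \<le> C1 * (1 + sqrt \<tau>) powr \<theta>"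
    using admissible_exponent_error[OF \<open>0 \<le> \<theta>\<close> l(1) adm, of u] by blast
  have "n \<ge> 1" "0 < u"
    using n l by auto
  from lattice_count_codim_1[OF this] obtain C2 where C2: "C2 \<ge> 0"
    "\<And>a \<tau>. a \<in> {1..n} \<rightarrow> {0<..u} \<Longrightarrow> \<tau> \<ge> 0 \<Longrightarrow> (\<Prod>i=1..n. a i) = 1 \<Longrightarrow>
    \<bar>(\<Sum>j=1..n. real (lattice_count \<int> ({1..n} - {j}) a \<tau>))
       - unit_ball_vol (real (n - 1)) * (\<Sum>j=1..n. 1 / a j) * sqrt \<tau> ^ (n - 1)\<bar> \<le> C2 * (1 + sqrt \<tau>) ^ (n - 2)"
    by blast
  obtain C3 where C3: "C3 \<ge> 0" "\<And>a \<tau>. a \<in> {1..n} \<rightarrow> {0<..u} \<Longrightarrow> \<tau> \<ge> 0 \<Longrightarrow>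
      real (\<Sum>S | S \<subseteq> {1..n} \<and> card S \<le> n - 2. lattice_count \<int> S a \<tau>) \<le> C3 * (1 + sqrt \<tau>) ^ (n - 2)"
    using sum_lattice_count_le[of "{1..n}" u "n - 2"] \<open>0 < u\<close> by blast
  \<comment> \<open>The full count and the codimension 1 sections are estimated for both cuboids,
    hence the factors 2. The smaller sections are dropped for \<open>a\<close>, being non-negative,
    and bounded above only for the cube.\<close>
  let ?C = "2 * C1 + 2 * C2 + C3"
  show ?thesis
  proof (intro exI[of _ ?C] conjI ballI allI impI)
    show "0 \<le> ?C"
      using C1 C2 C3 by simp
    fix a and \<tau> :: real assume a: "a \<in> {1..n} \<rightarrow> {l..u}" and \<tau>: "0 \<le> \<tau>" and prod: "(\<Prod>i=1..n. a i) = 1"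
    let ?one = "\<lambda>_::nat. 1::real" and ?P = "(1 + sqrt \<tau>) powr \<theta>"
    define Z1 Z2 Z3 where "Z1 b = real (lattice_count \<int> {1..n} b \<tau>)"
      and "Z2 b = (\<Sum>j=1..n. real (lattice_count \<int> ({1..n} - {j}) b \<tau>))"
      and "Z3 b = real (\<Sum>S | S \<subseteq> {1..n} \<and> card S \<le> n - 2. lattice_count \<int> S b \<tau>)" for b
    have a0: "a \<in> {1..n} \<rightarrow> {0<..u}" and one: "?one \<in> {1..n} \<rightarrow> {l..u}" "?one \<in> {1..n} \<rightarrow> {0<..u}"
      using a l by (auto simp: Pi_iff dest: less_le_trans)
    have N: "2 ^ n * real (lattice_count \<nat> {1..n} b \<tau>) = Z1 b + Z2 b + Z3 b"
      if "b \<in> {1..n} \<rightarrow> {0<..u}" for b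
    proof -
      have "2 ^ n * lattice_count \<nat> {1..n} b \<tau> = (\<Sum>S\<in>Pow {1..n}. lattice_count \<int> S b \<tau>)"
        using lattice_count_Nats_eq_sum[of "{1..n}" b \<tau>] that by (auto simp: Pi_iff)
      also have "\<dots> = lattice_count \<int> {1..n} b \<tau> + (\<Sum>j=1..n. lattice_count \<int> ({1..n} - {j}) b \<tau>)
          + (\<Sum>S | S \<subseteq> {1..n} \<and> card S \<le> n - 2. lattice_count \<int> S b \<tau>)"
        using sum_Pow_codim[of "{1..n}" "\<lambda>S. lattice_count \<int> S b \<tau>"] n by simp
      finally have "real (2 ^ n * lattice_count \<nat> {1..n} b \<tau>)
          = real (lattice_count \<int> {1..n} b \<tau> + (\<Sum>j=1..n. lattice_count \<int> ({1..n} - {j}) b \<tau>)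
            + (\<Sum>S | S \<subseteq> {1..n} \<and> card S \<le> n - 2. lattice_count \<int> S b \<tau>))"
        by (rule arg_cong)
      then show ?thesis
        unfolding Z1_def Z2_def Z3_def by simp
    qed
    have P: "(1 + sqrt \<tau>) ^ (n - 2) \<le> ?P"
    proof -
      have "(1 + sqrt \<tau>) ^ (n - 2) = (1 + sqrt \<tau>) powr real (n - 2)"
        using \<tau> by (intro powr_realpow [symmetric]) (simp add: add_pos_nonneg)
      also have "\<dots> \<le> ?P"
        using \<theta> n \<tau> by (intro powr_mono) (auto simp: of_nat_diff)
      finally show ?thesis .
    qed
    let ?V = "unit_ball_vol (real n) * sqrt \<tau> ^ n" and ?W = "unit_ball_vol (real (n - 1)) * sqrt \<tau> ^ (n - 1)"
    have "\<bar>Z1 a - ?V\<bar> \<le> C1 * ?P" "\<bar>Z1 ?one - ?V\<bar> \<le> C1 * ?P"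
      using C1(2)[OF a \<tau>] C1(2)[OF one(1) \<tau>] prod by (auto simp: Z1_def ellipsoid_vol_def)
    moreover have "\<bar>Z2 a - ?W * (\<Sum>j=1..n. 1 / a j)\<bar> \<le> C2 * ?P" "\<bar>Z2 ?one - ?W * real n\<bar> \<le> C2 * ?P"
    proof -
      have le: "C2 * (1 + sqrt \<tau>) ^ (n - 2) \<le> C2 * ?P"
        using C2(1) P by (rule mult_left_mono[rotated])
      have Z2: "\<bar>Z2 b - ?W * (\<Sum>j=1..n. 1 / b j)\<bar> \<le> C2 * ?P"
        if "b \<in> {1..n} \<rightarrow> {0<..u}" "(\<Prod>i=1..n. b i) = 1" for b
      proof -
        have "?W * (\<Sum>j=1..n. 1 / b j) = unit_ball_vol (real (n - 1)) * (\<Sum>j=1..n. 1 / b j) * sqrt \<tau> ^ (n - 1)"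
          by (simp only: mult_ac)
        then show ?thesis
          using order_trans[OF C2(2)[OF that(1) \<tau> that(2)] le] by (simp only: Z2_def)
      qed
      show "\<bar>Z2 a - ?W * (\<Sum>j=1..n. 1 / a j)\<bar> \<le> C2 * ?P"
        using a0 prod by (rule Z2)
      show "\<bar>Z2 ?one - ?W * real n\<bar> \<le> C2 * ?P"
        using Z2[OF one(2)] by simp
    qed
    moreover have "Z3 ?one \<le> C3 * ?P" "0 \<le> Z3 a"
    proof -
      have "C3 * (1 + sqrt \<tau>) ^ (n - 2) \<le> C3 * ?P"
        using C3(1) P by (rule mult_left_mono[rotated])
      then show "Z3 ?one \<le> C3 * ?P"
        using C3(2)[OF one(2) \<tau>] unfolding Z3_def by linarith
      show "0 \<le> Z3 a"
        unfolding Z3_def by (rule of_nat_0_le_iff)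
    qed
    ultimately have "?W * (\<Sum>j=1..n. 1 / a j) - ?W * real n - (2 * (C1 * ?P) + 2 * (C2 * ?P) + C3 * ?P)
        \<le> 2 ^ n * real (lattice_count \<nat> {1..n} a \<tau>) - 2 ^ n * real (lattice_count \<nat> {1..n} ?one \<tau>)"
      unfolding N[OF a0] N[OF one(2)] by linarith
    then have "?W * ((\<Sum>j=1..n. 1 / a j) - real n) - ?C * ?P
        \<le> 2 ^ n * (real (lattice_count \<nat> {1..n} a \<tau>) - real (lattice_count \<nat> {1..n} ?one \<tau>))"
      by (simp add: algebra_simps)
    then have "(?W * ((\<Sum>j=1..n. 1 / a j) - real n) - ?C * ?P) / 2 ^ n
        \<le> real (lattice_count \<nat> {1..n} a \<tau>) - real (lattice_count \<nat> {1..n} ?one \<tau>)"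
      by (simp add: pos_divide_le_eq mult.commute)
    moreover have "?C * ?P / 2 ^ n \<le> ?C * ?P"
      using \<open>0 \<le> ?C\<close> by (intro divide_left_mono[of 1, simplified]) auto
    ultimately show "unit_ball_vol (real (n - 1)) / 2 ^ n * ((\<Sum>j=1..n. 1 / a j) - real n) * sqrt \<tau> ^ (n - 1)
        - ?C * (1 + sqrt \<tau>) powr \<theta>
      \<le> real (lattice_count \<nat> {1..n} a \<tau>) - real (lattice_count \<nat> {1..n} ?one \<tau>)"
      by (simp add: diff_divide_distrib mult_ac)
  qed
qed

text \<open>With \<open>b j = 1 / a j\<close> the product condition turns the left-hand side into the sum of the
  non-negative terms \<open>b j - 1 - ln (b j)\<close>, and \<open>ln b = 2 ln (sqrt b) \<le> 2 (sqrt b - 1)\<close>.\<close>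

lemma sum_inverse_sides_ge:
  assumes unit: "unit_cuboid n a" and n: "n \<ge> 1" and u: "1 \<le> a n" "a n \<le> u"
  shows "((a n - 1) / (2 * u))\<^sup>2 \<le> (\<Sum>j=1..n. 1 / a j) - real n"
proof -
  have pos: "\<And>j. j \<in> {1..n} \<Longrightarrow> 0 < a j" and prod: "(\<Prod>i=1..n. a i) = 1"
    using unit by (auto simp: unit_cuboid_def)
  let ?h = "\<lambda>b. b - 1 - ln b :: real"
  have h: "(1 - sqrt b)\<^sup>2 \<le> ?h b" if "0 < b" for b
  proof -
    have "ln b = 2 * ln (sqrt b)"
      using that by (simp add: ln_sqrt)
    also have "\<dots> \<le> 2 * (sqrt b - 1)"
      using that by (intro mult_left_mono ln_le_minus_one) auto
    finally show ?thesis
      using that by (simp add: power2_diff)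
  qed
  have "(\<Sum>j=1..n. ln (a j)) = 0"
    using ln_prod[of "{1..n}" a] pos prod by (force simp: less_imp_neq[symmetric])
  moreover have "(\<Sum>j=1..n. ?h (1 / a j)) = (\<Sum>j=1..n. 1 / a j - 1 + ln (a j))"
  proof (rule sum.cong)
    show "?h (1 / a j) = 1 / a j - 1 + ln (a j)" if "j \<in> {1..n}" for j
      using pos[OF that] by (simp add: ln_div)
  qed simp
  ultimately have "(\<Sum>j=1..n. 1 / a j) - real n = (\<Sum>j=1..n. ?h (1 / a j))"
    by (simp only: sum_subtractf sum.distrib) simp
  moreover have "?h (1 / a n) \<le> (\<Sum>j=1..n. ?h (1 / a j))"
  proof (rule member_le_sum)
    show "0 \<le> ?h (1 / a j)" if "j \<in> {1..n} - {n}" for j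
      using order_trans[OF zero_le_power2 h[of "1 / a j"]] pos[of j] that by simp
  qed (use n in auto)
  \<comment> \<open>With \<open>r = sqrt (1 / a n)\<close>, one has
    \<open>(1 - r) * (1 + r) = (a n - 1) / a n\<close>, where \<open>1 + r \<le> 2\<close> and
    \<open>a n \<le> u\<close>.\<close>
  moreover have "((a n - 1) / (2 * u))\<^sup>2 \<le> (1 - sqrt (1 / a n))\<^sup>2"
  proof (rule power_mono)
    let ?r = "sqrt (1 / a n)"
    have r: "0 \<le> ?r" "?r \<le> 1"
      using u by auto
    have "(a n - 1) / (2 * u) \<le> (a n - 1) / (2 * a n)"
      using u by (intro divide_left_mono) auto
    also have "\<dots> = (1 - ?r\<^sup>2) / 2"
      using u by (simp add: field_simps)
    also have "\<dots> = (1 - ?r) * (1 + ?r) / 2"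
      by (simp add: algebra_simps power2_eq_square)
    also have "\<dots> \<le> (1 - ?r) * 2 / 2"
      using r by (intro divide_right_mono mult_left_mono) auto
    also have "\<dots> = 1 - ?r"
      by simp
    finally show "(a n - 1) / (2 * u) \<le> 1 - ?r" .
  qed (use u in auto)
  ultimately show ?thesis
    using h[of "1 / a n"] pos[of n] n by auto
qed

section \<open>The rate for minimisers\<close>

theorem proposition4p2:
  fixes n :: nat and \<gamma> \<theta> :: real and a :: "real \<Rightarrow> nat \<Rightarrow> real"
  assumes "n \<ge> 2" and "\<gamma> \<ge> 0"
    and "admissible_exponent n \<theta>"
    and "\<And>\<mu>. \<mu> > 0 \<Longrightarrow> minimising_cuboid n \<gamma> \<mu> (a \<mu>)"
  shows "(\<lambda>\<mu>. a \<mu> n - 1) \<in> O[at_top](\<lambda>\<mu>. \<mu> powr ((\<theta> - (real n - 1)) / 4))"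
proof -
  note n = assms(1) and \<gamma> = assms(2) and adm = assms(3)
  let ?m = "n - 1" and ?one = "\<lambda>_::nat. 1::real"
  have "0 \<le> \<theta>"
    using admissible_exponent_ge[OF n adm] n by simp
  obtain B where B: "0 < B" "\<And>\<mu> a. \<mu> \<ge> 1 \<Longrightarrow> minimising_cuboid n \<gamma> \<mu> a \<Longrightarrow> 1 / B \<le> a 1"
    using minimising_cuboid_thickness[OF n \<gamma>] by blast
  define l u where "l = min 1 (1 / B)" and "u = max 1 (B ^ ?m)"
  have l: "0 < l" "l \<le> 1" "1 \<le> u"
    using B(1) by (auto simp: l_def u_def)
  obtain C where C: "C \<ge> 0" "\<And>a \<tau>. a \<in> {1..n} \<rightarrow> {l..u} \<Longrightarrow> \<tau> \<ge> 0 \<Longrightarrow> (\<Prod>i=1..n. a i) = 1 \<Longrightarrow>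
    unit_ball_vol (real ?m) / 2 ^ n * ((\<Sum>j=1..n. 1 / a j) - real n) * sqrt \<tau> ^ ?m
      - C * (1 + sqrt \<tau>) powr \<theta>
    \<le> real (lattice_count \<nat> {1..n} a \<tau>) - real (lattice_count \<nat> {1..n} ?one \<tau>)"
    using lattice_count_Nats_compare_cube[OF n adm l] by blast
  define d where "d = unit_ball_vol (real ?m) / 2 ^ n"
  have d: "0 < d"
    by (simp add: d_def)
  define K where "K = C * 2 powr \<theta> * pi ^ ?m * sqrt 2 ^ ?m * 2 powr \<gamma> / d"
  have K: "0 \<le> K"
    using C(1) d by (simp add: K_def)
  have bound: "\<bar>a \<mu> n - 1\<bar> \<le> 2 * u * sqrt K * \<mu> powr ((\<theta> - (real n - 1)) / 4)" if \<mu>: "1 \<le> \<mu>" for \<mu>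
  proof -
    have min: "minimising_cuboid n \<gamma> \<mu> (a \<mu>)"
      using assms(4) \<mu> by simp
    have unit: "unit_cuboid n (a \<mu>)"
      using min by (simp add: minimising_cuboid_def is_arg_min_def)
    have le: "neumann_riesz_mean n \<gamma> \<mu> (a \<mu>) \<le> neumann_riesz_mean n \<gamma> \<mu> ?one"
      using min unit_cube[of n] by (auto simp: minimising_cuboid_def is_arg_min_def not_less)
    have pos: "\<And>j. j \<in> {1..n} \<Longrightarrow> 0 < a \<mu> j" and prod: "(\<Prod>i=1..n. a \<mu> i) = 1"
      using unit by (auto simp: unit_cuboid_def)
    have "n \<ge> 1"
      using n by simp
    note bounds = unit_cuboid_bounded[OF unit this B(1) B(2)[OF \<mu> min]]
    have an: "1 \<le> a \<mu> n" "a \<mu> n \<le> u"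
      using bounds(2,3) by (auto simp: u_def)
    have range: "a \<mu> \<in> {1..n} \<rightarrow> {l..u}"
    proof
      fix j assume j: "j \<in> {1..n}"
      show "a \<mu> j \<in> {l..u}"
        using bounds(1)[OF j] bounds(4)[OF j] an by (auto simp: l_def)
    qed
    define S where "S = (\<Sum>j=1..n. 1 / a \<mu> j) - real n"
    have S: "((a \<mu> n - 1) / (2 * u))\<^sup>2 \<le> S"
      unfolding S_def using unit \<open>n \<ge> 1\<close> an by (rule sum_inverse_sides_ge)
    then have "0 \<le> S"
      by (rule order_trans[OF zero_le_power2])
    have "d * S / pi ^ ?m * sqrt (\<mu> / 2) ^ ?m * (\<mu> / 2) powr \<gamma>
        \<le> C * (1 + sqrt (\<mu> / pi\<^sup>2)) powr \<theta> * \<mu> powr \<gamma>"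
    proof (rule neumann_riesz_mean_compare[OF \<open>n \<ge> 1\<close> \<gamma> _ pos _ _ le])
      fix s :: real assume s: "0 \<le> s" "s \<le> \<mu>"
      let ?\<tau> = "s / pi\<^sup>2"
      have \<tau>: "0 \<le> ?\<tau>"
        using s by simp
      have "d * S / pi ^ ?m * sqrt s ^ ?m = d * S * sqrt ?\<tau> ^ ?m"
        by (simp add: real_sqrt_divide power_divide)
      \<comment> \<open>Since \<open>0 \<le> \<theta>\<close>, the error is largest at
        \<open>s = \<mu>\<close>; its value there serves as the constant \<open>E\<close> of the
        comparison.\<close>
      moreover have "C * (1 + sqrt ?\<tau>) powr \<theta> \<le> C * (1 + sqrt (\<mu> / pi\<^sup>2)) powr \<theta>"
        using C(1) s \<open>0 \<le> \<theta>\<close>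
        by (intro mult_left_mono powr_mono2 add_left_mono real_sqrt_le_mono divide_right_mono) auto
      ultimately show "d * S / pi ^ ?m * sqrt s ^ ?m - C * (1 + sqrt (\<mu> / pi\<^sup>2)) powr \<theta>
          \<le> real (mode_count n (a \<mu>) s) - real (mode_count n ?one s)"
        using C(2)[OF range \<tau> prod] unfolding mode_count_eq d_def S_def by linarith
    qed (use \<mu> d \<open>0 \<le> S\<close> in auto)
    also have "\<dots> \<le> C * (2 * sqrt \<mu>) powr \<theta> * \<mu> powr \<gamma>"
      using C(1) \<mu> sqrt_scale_le[OF \<mu>] \<open>0 \<le> \<theta>\<close> by (intro mult_right_mono mult_left_mono powr_mono2) auto
    finally have "d * S / pi ^ ?m * (sqrt \<mu> ^ ?m / sqrt 2 ^ ?m) * (\<mu> powr \<gamma> / 2 powr \<gamma>)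
        \<le> C * (2 powr \<theta> * sqrt \<mu> powr \<theta>) * \<mu> powr \<gamma>"
      using \<mu> by (simp add: real_sqrt_divide power_divide powr_divide powr_mult)
    then have "d * S * sqrt \<mu> ^ ?m
        \<le> C * (2 powr \<theta> * sqrt \<mu> powr \<theta>) * pi ^ ?m * sqrt 2 ^ ?m * 2 powr \<gamma>"
      using \<mu> by (intro clear_denominators) auto
    also have "\<dots> = d * (K * sqrt \<mu> powr \<theta>)"
      using d by (simp add: K_def)
    finally have "S * sqrt \<mu> ^ ?m \<le> K * sqrt \<mu> powr \<theta>"
      using d by (simp add: mult.assoc)
    moreover have "sqrt \<mu> ^ ?m = \<mu> powr ((real n - 1) / 2)" "sqrt \<mu> powr \<theta> = \<mu> powr (\<theta> / 2)"
    proof -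
      have "sqrt \<mu> ^ ?m = sqrt \<mu> powr (real n - 1)"
        using \<mu> n by (simp add: powr_realpow [symmetric] of_nat_diff)
      then show "sqrt \<mu> ^ ?m = \<mu> powr ((real n - 1) / 2)" "sqrt \<mu> powr \<theta> = \<mu> powr (\<theta> / 2)"
        using \<mu> by (auto simp: powr_half_sqrt [symmetric] powr_powr)
    qed
    ultimately have "S \<le> K * (\<mu> powr (\<theta> / 2) / \<mu> powr ((real n - 1) / 2))"
      using \<mu> by (simp add: field_simps)
    \<comment> \<open>The excess \<open>S\<close> is of order
      \<open>t powr (\<theta> - (n - 1))\<close> with \<open>t\<close> of order
      \<open>sqrt \<mu>\<close>, which gives the exponent over 2; undoing the square in
      \<open>S\<close> gives the exponent over 4.\<close>
    also have "\<mu> powr (\<theta> / 2) / \<mu> powr ((real n - 1) / 2) = (\<mu> powr ((\<theta> - (real n - 1)) / 4))\<^sup>2"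
    proof -
      have "(\<theta> - (real n - 1)) / 4 + (\<theta> - (real n - 1)) / 4 = \<theta> / 2 - (real n - 1) / 2"
        by (simp add: field_simps)
      then show ?thesis
        by (simp only: power2_eq_square powr_add [symmetric] powr_diff)
    qed
    finally have "((a \<mu> n - 1) / (2 * u))\<^sup>2 \<le> (sqrt K * \<mu> powr ((\<theta> - (real n - 1)) / 4))\<^sup>2"
      using S K by (simp add: power_mult_distrib)
    then have "(a \<mu> n - 1) / (2 * u) \<le> sqrt K * \<mu> powr ((\<theta> - (real n - 1)) / 4)"
      by (rule power2_le_imp_le) (use K in simp)
    then show ?thesis
      using an l by (simp add: field_simps)
  qed
  show ?thesis
  proof (rule bigoI[where c = "2 * u * sqrt K"])
    show "\<forall>\<^sub>F \<mu> in at_top. norm (a \<mu> n - 1)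
        \<le> 2 * u * sqrt K * norm (\<mu> powr ((\<theta> - (real n - 1)) / 4))"
      using eventually_ge_at_top[of 1] by eventually_elim (use bound in simp)
  qed
qed

end
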